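(* For any choice of positive integers $e$ and $r$, the augmented presentation $\langle\mathcal A\mid\mathcal R^+\rangle$ (with $n=r-1$) is right complete. Thus the monoid $B^+$ it defines is left cancellative, and the partial order on $B^+$ defined by left division is a lattice.
   Context: **Generators and relations.** Put $n=r-1$. Subscripts are integers modulo $n$ (represented in $\{0,\dots,n-1\}$; inequalities $p<q$ refer to these representatives), exponents ${}^{(i)}$ are integers modulo $e$. A sequence $(a_1,\dots,a_k)$ of distinct integers modulo $n$ is cyclically ordered if representatives can be chosen with $a_1<\dots<a_k<a_1+n$. Generators: $\mathcal A=\{a_{pq}\mid 0\le p,q<n,\ p\ne q\}\cup\{a_p^{(i)}\mid 0\le p<n,\ 0\le i<e\}$. Write $t_p=a_p^{(1)}a_p^{(0)}$. Relations $\mathcal R$ (here $r,s$ denote subscripts): - for $(p,q,r,s)$ cyclically ordered: $(\mathcal R_1)$ $a_{pq}a_{rs}=a_{rs}a_{pq}$; $(\mathcal R_2)$ $a_{ps}a_{qr}=a_{qr}a_{ps}$; - for $(p,q,r)$ cyclically ordered and any $i$: $(\mathcal R_3)$ $a_{pq}a_{qr}=a_{qr}a_{pr}=a_{pr}a_{pq}$; $(\mathcal R_4)$ $a_{pq}a_r^{(i)}=a_r^{(i)}a_{pq}$; - for $p\ne q$ and any $i$: $(\mathcal R_5)$ $a_{pq}a_q^{(j)}=a_q^{(j)}a_p^{(i)}=a_p^{(i)}a_{pq}$, with $j=i$ if $p<q$ and $j=i+1$ otherwise; - for every $p$: $(\mathcal R_6)$ all words $a_p^{(i)}a_p^{(i-1)}$,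 $i\in\mathbb Z/e$, are equal. A chain of equalities stands for all pairwise equalities. The augmented relations $\mathcal R^+$ are $\mathcal R$ together with the following consequences of $\mathcal R$: - for $(p,q,r,s)$ cyclically ordered: $(\mathcal C_1)$ $a_{pr}a_{pq}a_{rs}=a_{qs}a_{ps}a_{qr}$; $(\mathcal C_2)$ $a_{ps}a_{pq}a_{qr}t_s=a_{rq}a_{rp}a_{rs}t_q$; - for $(p,q,r)$ cyclically ordered and any $i$: $(\mathcal C_3)$ $a_{pr}a_{pq}t_r=a_{qp}a_{qr}t_p$; $(\mathcal C_4)$ $a_{pr}a_{pq}a_r^{(k)}=a_q^{(i)}a_{qr}a_p^{(j)}$, with $j=i$ if $p<q$, $j=i-1$ otherwise, and $k=i$ if $q<r$, $k=i+1$ otherwise; - for $p<q$: $(\mathcal C_5)$ $a_{pq}t_q=a_{qp}t_p$; and $(\mathcal C_6)$ $a_p^{(i)}a_p^{(i-1)}a_{pq}=a_q^{(j)}a_q^{(j-1)}a_{qp}$ for all $i,j$ with $i\not\equiv j,\ j+1 \pmod e$. $B^+$ is the monoid defined by $\langle\mathcal A\mid\mathcal R\rangle$, equivalently by $\langle\mathcal A\mid\mathcal R^+\rangle$. **Word reversing and completeness.** For words over $\mathcal A\cup\mathcal A^{-1}$, a one-step reversing replaces a subword $x^{-1}y$ ($x,y\in\mathcal A$) by the empty word $\varepsilon$ if $x=y$, and by $uv^{-1}$ if $x\neq y$ and $xu=yv$ is a relation in $\mathcal R^+$. Write $w\curvearrowright w'$ if $w'$ is obtained from $w$ by finitely many one-step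 reversings. The presentation is *right complete* (Dehornoy) if, whenever two positive words $u,v\in\mathcal A^*$ represent the same element of the monoid, $u^{-1}v\curvearrowright\varepsilon$. **Left division.** $x$ left divides $y$ if $y=xz$ for some $z$ in the monoid.
   Formalization: The case e = 1, r ≥ 3 is excluded: there R5 gives a_0^(0) and a_1^(0) two distinct common right multiples of length 2, a_1^(0)a_0^(0) and a_0^(0)a_1^(0), so left division is not a lattice order. *)

theory Defs
  imports "HOL-Algebra.Divisibility"
begin

section \<open>Monoid presentations and word reversing\<close>

text \<open>
  A relation is given as a set \<open>W\<close> of words, standing for all pairwise equalities between
  its members; so relations are symmetric, and a chain of equalities is a single set.
\<close>

definition is_rel :: "'g list set set \<Rightarrow> 'g list \<Rightarrow> 'g list \<Rightarrow> bool" where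
  "is_rel F u v \<longleftrightarrow> (\<exists>W\<in>F. u \<in> W \<and> v \<in> W)"

inductive rewrite_step :: "'g list set set \<Rightarrow> 'g list \<Rightarrow> 'g list \<Rightarrow> bool" for F where
  "is_rel F u v \<Longrightarrow> rewrite_step F (a @ u @ b) (a @ v @ b)"

definition word_eq :: "'g set \<Rightarrow> 'g list set set \<Rightarrow> ('g list \<times> 'g list) set" where
  "word_eq X F = {(u, v). u \<in> lists X \<and> v \<in> lists X \<and> (rewrite_step F)\<^sup>*\<^sup>* u v}"

definition presented_monoid :: "'g set \<Rightarrow> 'g list set set \<Rightarrow> 'g list set monoid" where
  "presented_monoid X F =
     \<lparr>carrier = lists X // word_eq X F,
      mult = (\<lambda>U V. \<Union>u\<in>U. \<Union>v\<in>V. word_eq X F `` {u @ v}),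
      one = word_eq X F `` {[]}\<rparr>"

datatype 'g signed = Pos 'g | Neg 'g

inductive reversing_step :: "'g list set set \<Rightarrow> 'g signed list \<Rightarrow> 'g signed list \<Rightarrow> bool" for F where
  "reversing_step F (a @ [Neg x, Pos x] @ b) (a @ b)"
| "x \<noteq> y \<Longrightarrow> is_rel F (x # u) (y # v) \<Longrightarrow>
     reversing_step F (a @ [Neg x, Pos y] @ b) (a @ map Pos u @ map Neg (rev v) @ b)"

definition right_complete :: "'g set \<Rightarrow> 'g list set set \<Rightarrow> bool" where
  "right_complete X F \<longleftrightarrow>
     (\<forall>(u, v)\<in>word_eq X F. (reversing_step F)\<^sup>*\<^sup>* (map Neg (rev u) @ map Pos v) [])"

definition left_cancellative :: "('a, 'b) monoid_scheme \<Rightarrow> bool" where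
  "left_cancellative M \<longleftrightarrow>
     (\<forall>x\<in>carrier M. \<forall>y\<in>carrier M. \<forall>z\<in>carrier M. x \<otimes>\<^bsub>M\<^esub> y = x \<otimes>\<^bsub>M\<^esub> z \<longrightarrow> y = z)"

text \<open>
  The library relation \<open>divides\<close> is left division. Unlike \<open>division_rel\<close>, equality in the
  order below is true equality and not associatedness, so that antisymmetry is part of
  being a lattice.
\<close>

definition left_division_order :: "('a, 'b) monoid_scheme \<Rightarrow> 'a gorder" where
  "left_division_order M = \<lparr>carrier = carrier M, eq = (=), le = (divides\<^bsub>M\<^esub>)\<rparr>"


section \<open>The presentation\<close>

text \<open>
  \<open>A p q\<close> is $a_{pq}$ and \<open>E p i\<close> is $a_p^{(i)}$ with \<open>i\<close> the representative in
  $\{0,\dots,e-1\}$; \<open>ap e p i\<close> is $a_p^{(i)}$ for an arbitrary integer \<open>i\<close>.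
\<close>

datatype gen = A nat nat | E nat nat

definition gens :: "nat \<Rightarrow> nat \<Rightarrow> gen set" where
  "gens e n = {A p q | p q. p < n \<and> q < n \<and> p \<noteq> q} \<union> {E p i | p i. p < n \<and> i < e}"

definition ap :: "nat \<Rightarrow> nat \<Rightarrow> int \<Rightarrow> gen" where
  "ap e p i = E p (nat (i mod int e))"

definition t :: "nat \<Rightarrow> nat \<Rightarrow> gen list" where
  "t e p = [ap e p 1, ap e p 0]"

definition cyc :: "nat \<Rightarrow> nat list \<Rightarrow> bool" where
  "cyc n ps \<longleftrightarrow> (\<exists>bs :: int list. map (\<lambda>b. b mod int n) bs = map int ps \<and>
     sorted_wrt (<) bs \<and> last bs < hd bs + int n)"

inductive_set rels_R :: "nat \<Rightarrow> nat \<Rightarrow> gen list set set" for e n where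
  R1: "cyc n [p, q, r, s] \<Longrightarrow>
    {[A p q, A r s], [A r s, A p q]} \<in> rels_R e n"
| R2: "cyc n [p, q, r, s] \<Longrightarrow>
    {[A p s, A q r], [A q r, A p s]} \<in> rels_R e n"
| R3: "cyc n [p, q, r] \<Longrightarrow>
    {[A p q, A q r], [A q r, A p r], [A p r, A p q]} \<in> rels_R e n"
| R4: "cyc n [p, q, r] \<Longrightarrow>
    {[A p q, ap e r i], [ap e r i, A p q]} \<in> rels_R e n"
| R5: "p < n \<Longrightarrow> q < n \<Longrightarrow> p \<noteq> q \<Longrightarrow> j = (if p < q then i else i + 1) \<Longrightarrow>
    {[A p q, ap e q j], [ap e q j, ap e p i], [ap e p i, A p q]} \<in> rels_R e n"
| R6: "p < n \<Longrightarrow>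
    {[ap e p i, ap e p (i - 1)] | i. True} \<in> rels_R e n"

inductive_set rels_C :: "nat \<Rightarrow> nat \<Rightarrow> gen list set set" for e n where
  C1: "cyc n [p, q, r, s] \<Longrightarrow>
    {[A p r, A p q, A r s], [A q s, A p s, A q r]} \<in> rels_C e n"
| C2: "cyc n [p, q, r, s] \<Longrightarrow>
    {[A p s, A p q, A q r] @ t e s, [A r q, A r p, A r s] @ t e q} \<in> rels_C e n"
| C3: "cyc n [p, q, r] \<Longrightarrow>
    {[A p r, A p q] @ t e r, [A q p, A q r] @ t e p} \<in> rels_C e n"
| C4: "cyc n [p, q, r] \<Longrightarrow>
    j = (if p < q then i else i - 1) \<Longrightarrow> k = (if q < r then i else i + 1) \<Longrightarrow>
    {[A p r, A p q, ap e r k], [ap e q i, A q r, ap e p j]} \<in> rels_C e n"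
| C5: "p < q \<Longrightarrow> q < n \<Longrightarrow>
    {[A p q] @ t e q, [A q p] @ t e p} \<in> rels_C e n"
| C6: "p < q \<Longrightarrow> q < n \<Longrightarrow>
    i mod int e \<noteq> j mod int e \<Longrightarrow> i mod int e \<noteq> (j + 1) mod int e \<Longrightarrow>
    {[ap e p i, ap e p (i - 1), A p q], [ap e q j, ap e q (j - 1), A q p]} \<in> rels_C e n"

definition rels_Rplus :: "nat \<Rightarrow> nat \<Rightarrow> gen list set set" where
  "rels_Rplus e n = rels_R e n \<union> rels_C e n"

text \<open>
  Pitfall: for \<open>e = 1\<close> and \<open>n \<ge> 2\<close>, relation \<open>R5\<close> applied to $(p,q)$ and to $(q,p)$ gives the
  generators $a_p^{(0)} \neq a_q^{(0)}$ two distinct common right multiples of length 2, so left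
  division is not a lattice order on this monoid.
\<close>

definition Bplus :: "nat \<Rightarrow> nat \<Rightarrow> gen list set monoid" where
  "Bplus e n = presented_monoid (gens e n) (rels_Rplus e n)"

end

theory Submission
  imports Defs
begin

text \<open>
  All relations preserve length, so cancellation and the existence of conditional lcms can be
  proved by induction on the length of words. Since $R$ alone presents the monoid, an equality
  $xu = yv$ is a chain of swaps $zg = yh$ from $R$. Following the chain, the property that
  every common right multiple of $x$ and $z$ is a right multiple of the one given by $R^+$ is
  transported from $(x,z)$ to $(x,y)$; this needs the cube condition for the triple $x,z,y$, in
  which only one letter $g$ has to be reversed against the complement of $x$ in $z$.

  The complement of two generators depends only on the order of their subscripts and on the
  adjacency of their exponents. Hence the cube condition for a triple is the image of the cube
  condition for a triple with at most six subscripts and few exponents, and these are computed.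

  Lcms of all pairs exist because $\<delta> = a_{01} a_{12} \<cdots> a_{n-2,n-1} t_{n-1}$ is quasi-central
  and every generator divides $\<delta>^2$.
\<close>

section \<open>Presentations satisfying the cube condition\<close>

text \<open>Two features of the relations shape the proof. First, t_p is written with the exponents
  1 and 0, whereas the reduction to finite models rotates exponents. So \<open>gcomp\<close> admits
  complements in which t_p starts from any exponent \<open>j\<close>. These versions are congruent
  by R6, hence complements are determined only up to congruence, and the abstract argument asks for
  no more. Only where actual reversings are produced are the complements restricted to relations of
  R+, which \<open>j = 0\<close> supplies. Second, R6 equates e words at once. If every pair of them
  counted as a swap, a triple could contain three exponents in arbitrary mutual position. Pairs with
  adjacent exponents generate the same congruence, and with them a triple has at most one free
  distance \<open>d\<close> between exponents. For e >= 8 the exponents reached then fit into a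
  window of 7, or into separate windows of 4 and 3; shorter cycles are computed as they are.\<close>

inductive swap_step :: "('g \<Rightarrow> 'g \<Rightarrow> 'g \<Rightarrow> 'g \<Rightarrow> bool) \<Rightarrow> 'g list \<Rightarrow> 'g list \<Rightarrow> bool" for S where
  "S z g y h \<Longrightarrow> swap_step S (a @ [z, g] @ b) (a @ [y, h] @ b)"

definition swap_eq :: "('g \<Rightarrow> 'g \<Rightarrow> 'g \<Rightarrow> 'g \<Rightarrow> bool) \<Rightarrow> 'g list \<Rightarrow> 'g list \<Rightarrow> bool" where
  "swap_eq S = (swap_step S)\<^sup>*\<^sup>*"

text \<open>\<open>reverses C u v c d\<close> says that $u^{-1}v$ reverses to $c d^{-1}$ when the relations
  $xa = yb$ used are those with \<open>C x a y b\<close>.\<close>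

inductive reverses :: "('g \<Rightarrow> 'g list \<Rightarrow> 'g \<Rightarrow> 'g list \<Rightarrow> bool) \<Rightarrow>
    'g list \<Rightarrow> 'g list \<Rightarrow> 'g list \<Rightarrow> 'g list \<Rightarrow> bool" for C where
  reverses_Nil1: "reverses C [] v v []"
| reverses_Nil2: "reverses C u [] [] u"
| reverses_same: "reverses C u v c d \<Longrightarrow> reverses C (x # u) (x # v) c d"
| reverses_diff: "C x a y b \<Longrightarrow> reverses C u a c1 d1 \<Longrightarrow> reverses C b v c2 d2 \<Longrightarrow>
    reverses C d1 c2 c3 d3 \<Longrightarrow> reverses C (x # u) (y # v) (c1 @ c3) (d2 @ d3)"

lemma reverses_mono:
  assumes "reverses C u v c d" "\<And>x a y b. C x a y b \<Longrightarrow> C' x a y b"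
  shows "reverses C' u v c d"
  using assms(1) by induction (auto intro: reverses.intros assms(2))

locale swap_presentation =
  fixes X :: "'g set" and S :: "'g \<Rightarrow> 'g \<Rightarrow> 'g \<Rightarrow> 'g \<Rightarrow> bool"
  assumes S_X: "S z g y h \<Longrightarrow> z \<in> X \<and> g \<in> X \<and> y \<in> X \<and> h \<in> X \<and> z \<noteq> y"
    and S_sym: "S z g y h \<Longrightarrow> S y h z g"
begin

abbreviation eqv (infix "\<approx>" 50) where "u \<approx> v \<equiv> swap_eq S u v"

lemma eqv_refl [simp, intro]: "u \<approx> u"
  by (simp add: swap_eq_def)

lemma eqv_trans [trans]: "u \<approx> v \<Longrightarrow> v \<approx> w \<Longrightarrow> u \<approx> w"
  by (simp add: swap_eq_def)

lemma eqv_sym: "u \<approx> v \<Longrightarrow> v \<approx> u"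
  unfolding swap_eq_def
proof (induction rule: rtranclp_induct)
  case (step v w)
  from step(2) have "swap_step S w v"
  proof cases
    case (1 z g y h a b)
    then show ?thesis using swap_step.intros[of S y h z g a b] S_sym by simp
  qed
  then show ?case using step(3) by (meson converse_rtranclp_into_rtranclp)
qed simp

lemma eqv_append: "u \<approx> v \<Longrightarrow> u' \<approx> v' \<Longrightarrow> u @ u' \<approx> v @ v'"
proof -
  have l: "a @ u \<approx> a @ v" if "u \<approx> v" for a u v
    using that unfolding swap_eq_def
  proof (induction rule: rtranclp_induct)
    case (step v w)
    from step(2) have "swap_step S (a @ v) (a @ w)"
      by cases (metis append.assoc swap_step.intros)
    then show ?case using step(3) by simp
  qed simp
  have r: "u @ a \<approx> v @ a" if "u \<approx> v" for a u v
    using that unfolding swap_eq_def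
  proof (induction rule: rtranclp_induct)
    case (step v w)
    from step(2) have "swap_step S (v @ a) (w @ a)"
    proof cases
      case (1 z g y h b c)
      then show ?thesis using swap_step.intros[of S z g y h b "c @ a"] by simp
    qed
    then show ?case using step(3) by simp
  qed simp
  show "u \<approx> v \<Longrightarrow> u' \<approx> v' \<Longrightarrow> u @ u' \<approx> v @ v'"
    using l r eqv_trans by blast
qed

lemma eqv_Cons: "u \<approx> v \<Longrightarrow> x # u \<approx> x # v"
  using eqv_append[of "[x]" "[x]"] by simp

lemma eqv_S: "S z g y h \<Longrightarrow> z # g # w \<approx> y # h # w"
  unfolding swap_eq_def using swap_step.intros[of S z g y h "[]" w] by auto

lemma eqv_length: "u \<approx> v \<Longrightarrow> length u = length v"
  unfolding swap_eq_def by (induction rule: rtranclp_induct) (auto elim!: swap_step.cases)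

lemma eqv_Nil: "[] \<approx> v \<longleftrightarrow> v = []"
  using eqv_length by fastforce

lemma eqv_lists: "u \<approx> v \<Longrightarrow> u \<in> lists X \<longleftrightarrow> v \<in> lists X"
  unfolding swap_eq_def
  by (induction rule: rtranclp_induct) (auto elim!: swap_step.cases dest!: S_X)

lemma reverses_eqv:
  assumes "reverses C u v c d" and C_sound: "\<And>x u y v. C x u y v \<Longrightarrow> x # u \<approx> y # v"
  shows "u @ c \<approx> v @ d"
  using assms(1)
proof (induction rule: reverses.induct)
  case (reverses_diff x a y b u c1 d1 v c2 d2 c3 d3)
  have "(x # u) @ c1 @ c3 \<approx> x # a @ d1 @ c3"
    using eqv_Cons[OF eqv_append[OF reverses_diff.IH(1) eqv_refl[of c3]], of x] by simp
  also have "\<dots> \<approx> y # b @ d1 @ c3"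
    using eqv_append[OF C_sound[OF reverses_diff.hyps(1)] eqv_refl[of "d1 @ c3"]] by simp
  also have "\<dots> \<approx> y # b @ c2 @ d3"
    using eqv_Cons[OF eqv_append[OF eqv_refl[of b] reverses_diff.IH(3)], of y] by simp
  also have "\<dots> \<approx> (y # v) @ d2 @ d3"
    using eqv_Cons[OF eqv_append[OF reverses_diff.IH(2) eqv_refl[of d3]], of y] by simp
  finally show ?case .
qed (auto intro: eqv_Cons)

end

text \<open>\<open>C\<close> may offer several congruent complements for a pair, not all of them
  relations of \<open>F\<close>; \<open>C_rel\<close> asks for one that is. In \<open>cube\<close>,
  the word x xz c equals z zx c, then z g d, then y h d. It is a common multiple of \<open>x\<close>
  and \<open>y\<close>, and the condition says that it passes through x u = y v, with remainder
  \<open>f\<close>.\<close>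

locale cube_presentation = swap_presentation X S
  for X :: "'g set" and S :: "'g \<Rightarrow> 'g \<Rightarrow> 'g \<Rightarrow> 'g \<Rightarrow> bool" +
  fixes F :: "'g list set set"
    and C :: "'g \<Rightarrow> 'g list \<Rightarrow> 'g \<Rightarrow> 'g list \<Rightarrow> bool"
  assumes S_rel: "S z g y h \<Longrightarrow> is_rel F [z, g] [y, h]"
    and S_C: "S z g y h \<Longrightarrow> C z [g] y [h]"
    and C_X: "C x u y v \<Longrightarrow> x \<in> X \<and> y \<in> X \<and> x \<noteq> y \<and> u \<in> lists X \<and> v \<in> lists X"
    and C_sound: "C x u y v \<Longrightarrow> swap_eq S (x # u) (y # v)"
    and C_unique: "C x u y v \<Longrightarrow> C x u' y v' \<Longrightarrow> swap_eq S u u' \<and> swap_eq S v v'"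
    and C_rel: "x \<in> X \<Longrightarrow> y \<in> X \<Longrightarrow> x \<noteq> y \<Longrightarrow> \<exists>u v. C x u y v \<and> is_rel F (x # u) (y # v)"
    and F_sound: "is_rel F u v \<Longrightarrow> swap_eq S u v"
    and cube: "S z g y h \<Longrightarrow> x \<in> X \<Longrightarrow> x \<noteq> z \<Longrightarrow> x \<noteq> y \<Longrightarrow>
      \<exists>xz zx c d u v f. C x xz z zx \<and> reverses C zx [g] c d \<and> C x u y v \<and>
        swap_eq S (xz @ c) (u @ f) \<and> swap_eq S (h # d) (v @ f)"
begin

section \<open>Cancellation and conditional lcms by induction on length\<close>

lemma C_length: "C x u y v \<Longrightarrow> length u = length v"
  using C_sound eqv_length by fastforce

lemmas reverses_sound = reverses_eqv[OF _ C_sound]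

lemma reverses_lists:
  "reverses C u v c d \<Longrightarrow> u \<in> lists X \<Longrightarrow> v \<in> lists X \<Longrightarrow> c \<in> lists X \<and> d \<in> lists X"
proof (induction rule: reverses.induct)
  case (reverses_diff x a y b u c1 d1 v c2 d2 c3 d3)
  then show ?case using C_X[OF reverses_diff.hyps(1)] by simp
qed auto

text \<open>Meant for x m = y m'. The two clauses exclude each other, since complements exist only
  for distinct letters: the first is left cancellation, the second says that the relation for
  \<open>x\<close> and \<open>y\<close> gives a least common multiple.\<close>

definition splits :: "'g \<Rightarrow> 'g list \<Rightarrow> 'g \<Rightarrow> 'g list \<Rightarrow> bool" where
  "splits x m y m' \<longleftrightarrow> (x = y \<longrightarrow> m \<approx> m') \<and>
     (\<forall>u v. C x u y v \<longrightarrow> (\<exists>k. m \<approx> u @ k \<and> m' \<approx> v @ k))"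

definition splits_upto :: "nat \<Rightarrow> bool" where
  "splits_upto N \<longleftrightarrow> (\<forall>x m y m'. x # m \<in> lists X \<longrightarrow> length m < N \<longrightarrow>
     x # m \<approx> y # m' \<longrightarrow> splits x m y m')"

lemma splits_uptoD:
  assumes "splits_upto N" "length m < N" "x # m \<approx> y # m'" "x # m \<in> lists X"
  shows "splits x m y m'"
  using assms unfolding splits_upto_def by blast

text \<open>A common multiple factors through every cell of the reversing diagram in turn. Each use
  of \<open>splits\<close> comes after removing a first letter, so it concerns a tail shorter than
  \<open>N\<close>; this makes the lemma available inside the induction on \<open>N\<close>.\<close>

lemma reverses_complete_upto:
  assumes "reverses C u v c d" "splits_upto N" "length (u @ m) \<le> N"
    "u @ m \<approx> v @ m'" "u @ m \<in> lists X"
  shows "\<exists>k. m \<approx> c @ k \<and> m' \<approx> d @ k"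
  using assms
proof (induction arbitrary: m m' rule: reverses.induct)
  case (reverses_Nil1 v)
  then show ?case by auto
next
  case (reverses_Nil2 u)
  then show ?case by (auto intro: eqv_sym)
next
  case (reverses_same u v c d x)
  have "splits x (u @ m) x (v @ m')"
    using reverses_same.prems by (intro splits_uptoD[of N]) auto
  then have "u @ m \<approx> v @ m'" by (simp add: splits_def)
  then show ?case using reverses_same.prems reverses_same.IH[of m m'] by simp
next
  case (reverses_diff x a y b u c1 d1 v c2 d2 c3 d3)
  have "splits x (u @ m) y (v @ m')"
    using reverses_diff.prems by (intro splits_uptoD[of N]) auto
  then obtain k where k: "u @ m \<approx> a @ k" "v @ m' \<approx> b @ k"
    using reverses_diff.hyps(1) unfolding splits_def by blast
  have len: "length (u @ m) < N" using reverses_diff.prems by simp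
  have X: "u @ m \<in> lists X" using reverses_diff.prems by simp
  obtain k1 where k1: "m \<approx> c1 @ k1" "k \<approx> d1 @ k1"
    using reverses_diff.IH(1)[OF _ _ k(1)] reverses_diff.prems len X by auto
  have lb: "length (b @ k) < N"
    using eqv_length[OF k(1)] len C_length[OF reverses_diff.hyps(1)] by simp
  have bX: "b @ k \<in> lists X"
    using eqv_lists[OF k(1)] X C_X[OF reverses_diff.hyps(1)] by simp
  obtain k2 where k2: "k \<approx> c2 @ k2" "m' \<approx> d2 @ k2"
    using reverses_diff.IH(2)[OF _ _ eqv_sym[OF k(2)]] reverses_diff.prems lb bX by auto
  have "d1 @ k1 \<approx> c2 @ k2" using k1(2) k2(1) eqv_sym eqv_trans by blast
  moreover have "length (d1 @ k1) \<le> N" using eqv_length[OF k1(2)] lb by simp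
  moreover have "d1 @ k1 \<in> lists X" using eqv_lists[OF k1(2)] bX by simp
  ultimately obtain k3 where k3: "k1 \<approx> c3 @ k3" "k2 \<approx> d3 @ k3"
    using reverses_diff.IH(3) reverses_diff.prems by blast
  have "m \<approx> c1 @ c3 @ k3"
    using eqv_trans[OF k1(1) eqv_append[OF eqv_refl k3(1)]] .
  moreover have "m' \<approx> d2 @ d3 @ k3"
    using eqv_trans[OF k2(2) eqv_append[OF eqv_refl k3(2)]] .
  ultimately show ?case by auto
qed

lemma splits_tail:
  assumes "splits x m y m'" "m' \<approx> m''"
  shows "splits x m y m''"
  using assms eqv_trans eqv_sym unfolding splits_def by metis

text \<open>Transports the factorization from the pair \<open>x\<close>, \<open>z\<close> to the
  pair \<open>x\<close>, \<open>y\<close> when a swap replaces the head \<open>z\<close> by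
  \<open>y\<close>. The tails may have length \<open>N\<close>, one more than
  \<open>splits_upto N\<close> allows; this gain drives the induction.\<close>

lemma splits_swap:
  assumes N: "splits_upto N" and len: "length (g # w) \<le> N" and X: "x # m \<in> lists X"
    and wX: "g # w \<in> lists X"
    and xz: "splits x m z (g # w)" and S: "S z g y h"
  shows "splits x m y (h # w)"
proof (cases "x = z")
  case True
  then have m: "m \<approx> g # w" and "x \<noteq> y" using xz S_X[OF S] by (auto simp: splits_def)
  moreover have "\<exists>k. m \<approx> u @ k \<and> h # w \<approx> v @ k" if "C x u y v" for u v
  proof -
    have "[g] \<approx> u" "[h] \<approx> v" using C_unique[OF S_C[OF S]] that True by auto
    then have "g # w \<approx> u @ w" "h # w \<approx> v @ w"
      using eqv_append[of "[g]" u w w] eqv_append[of "[h]" v w w] by auto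
    then show ?thesis using m eqv_trans by blast
  qed
  ultimately show ?thesis by (simp add: splits_def)
next
  case xnz: False
  show ?thesis
  proof (cases "x = y")
    case True
    obtain k where k: "m \<approx> [h] @ k" "g # w \<approx> [g] @ k"
      using xz S_C[OF S_sym[OF S]] True unfolding splits_def by blast
    \<comment> \<open>The letter \<open>g\<close> is cancelled in front of tails that are shorter
      than \<open>N\<close>.\<close>
    have "splits g w g k" using k(2) len wX by (intro splits_uptoD[OF N]) auto
    then have "w \<approx> k" by (simp add: splits_def)
    then have "m \<approx> h # w" using k(1) eqv_Cons eqv_sym eqv_trans by (metis append_Cons append_Nil)
    then show ?thesis using True C_X unfolding splits_def by blast
  next
    case False
    \<comment> \<open>The tail g w is a common multiple of \<open>zx\<close> and \<open>g\<close>.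
      Completeness at the smaller length factors it through \<open>c\<close> and \<open>d\<close>,
      after which the cube condition exchanges xz c for u f and h d for v f.\<close>
    obtain xz zx c d u0 v0 f where *: "C x xz z zx" "reverses C zx [g] c d" "C x u0 y v0"
        "xz @ c \<approx> u0 @ f" "h # d \<approx> v0 @ f"
      using cube[OF S _ xnz False] X by auto
    obtain k0 where k0: "m \<approx> xz @ k0" "g # w \<approx> zx @ k0"
      using xz *(1) unfolding splits_def by blast
    have "length (zx @ k0) \<le> N" using eqv_length[OF k0(2)] len by simp
    moreover have "zx @ k0 \<in> lists X" using eqv_lists[OF k0(2)] wX by simp
    ultimately obtain k where k: "k0 \<approx> c @ k" "w \<approx> d @ k"
      using reverses_complete_upto[OF *(2) N, of k0 w] eqv_sym[OF k0(2)] by auto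
    have "m \<approx> xz @ c @ k" using eqv_trans[OF k0(1) eqv_append[OF eqv_refl k(1)]] .
    also have "\<dots> \<approx> u0 @ f @ k" using eqv_append[OF *(4) eqv_refl[of k]] by simp
    finally have m: "m \<approx> u0 @ f @ k" .
    have "h # w \<approx> h # d @ k" using eqv_Cons[OF k(2)] .
    also have "\<dots> \<approx> v0 @ f @ k" using eqv_append[OF *(5) eqv_refl[of k]] by simp
    finally have h: "h # w \<approx> v0 @ f @ k" .
    have "m \<approx> u @ f @ k \<and> h # w \<approx> v @ f @ k" if "C x u y v" for u v
      using C_unique[OF *(3) that] m h eqv_trans eqv_append eqv_refl by meson
    then show ?thesis using False by (auto simp: splits_def)
  qed
qed

text \<open>\<open>x # m\<close> stays fixed while the other side runs along a chain of swaps,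
  starting from \<open>x # m\<close> itself. A swap behind the head only changes the tail by a
  congruent word; a swap at the head is \<open>splits_swap\<close>.\<close>

lemma splits_upto_Suc:
  assumes N: "splits_upto N"
  shows "splits_upto (Suc N)"
proof -
  have main: "\<forall>y m'. w = y # m' \<longrightarrow> splits x m y m'"
    if "x # m \<in> lists X" "length m < Suc N" "x # m \<approx> w" for x m w
    using that(3) unfolding swap_eq_def
  proof (induction rule: rtranclp_induct)
    case base
    show ?case by (auto simp: splits_def dest: C_X)
  next
    case (step v w)
    have v: "x # m \<approx> v" using step(1) by (simp add: swap_eq_def)
    from step(2) show ?case
    proof cases
      case (1 z g y h a b)
      show ?thesis
      proof (cases a)
        case Nil
        have "length (g # b) \<le> N" using eqv_length[OF v] that(2) 1 Nil by simp
        moreover have "g # b \<in> lists X" using eqv_lists[OF v] that(1) 1 Nil by simp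
        ultimately show ?thesis
          using splits_swap[OF N _ that(1), of g b z y h] step.IH 1 Nil by auto
      next
        case (Cons p a')
        have "a' @ [z, g] @ b \<approx> a' @ [y, h] @ b"
          using eqv_append[OF eqv_refl eqv_S] 1(3) by simp
        then show ?thesis using splits_tail step.IH 1 Cons by auto
      qed
    qed
  qed
  show ?thesis unfolding splits_upto_def using main by blast
qed

lemma splits_all: "x # m \<approx> y # m' \<Longrightarrow> x # m \<in> lists X \<Longrightarrow> splits x m y m'"
proof -
  have "splits_upto N" for N
    by (induction N) (simp add: splits_upto_def, rule splits_upto_Suc)
  then show "x # m \<approx> y # m' \<Longrightarrow> x # m \<in> lists X \<Longrightarrow> splits x m y m'"
    using splits_uptoD[of "Suc (length m)"] by blast
qed

lemma splits_upto: "splits_upto N"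
  using splits_all by (simp add: splits_upto_def)

lemma reverses_complete:
  assumes "reverses C u v c d" "u @ m \<approx> v @ m'" "u @ m \<in> lists X"
  shows "\<exists>k. m \<approx> c @ k \<and> m' \<approx> d @ k"
  using reverses_complete_upto[OF assms(1) splits_upto _ assms(2,3)] by blast

lemma eqv_cancel: "w @ u \<approx> w @ v \<Longrightarrow> w @ u \<in> lists X \<Longrightarrow> u \<approx> v"
proof (induction w)
  case (Cons x w)
  then show ?case using splits_all[of x "w @ u" x "w @ v"] by (simp add: splits_def)
qed simp

text \<open>Reversing terminates because every subproblem inherits a strictly shorter common
  multiple. \<open>?D\<close> keeps only complements that are relations of \<open>F\<close>, as the
  definition of right completeness demands.\<close>

lemma reverses_exists:
  assumes "u @ m \<approx> v @ m'" "u @ m \<in> lists X"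
  shows "\<exists>c d. reverses (\<lambda>x u y v. C x u y v \<and> is_rel F (x # u) (y # v)) u v c d"
    (is "\<exists>c d. reverses ?D u v c d")
  using assms
proof (induction "length (u @ m)" arbitrary: u m v m' rule: less_induct)
  case less
  have D: "reverses C u v c d" if "reverses ?D u v c d" for u v c d
    using reverses_mono[OF that] by blast
  show ?case
  proof (cases "u = [] \<or> v = []")
    case True
    then show ?thesis using reverses_Nil1 reverses_Nil2 by blast
  next
    case False
    then obtain x u1 y v1 where uv: "u = x # u1" "v = y # v1"
      by (meson neq_Nil_conv)
    have sp: "splits x (u1 @ m) y (v1 @ m')"
      using less.prems uv by (intro splits_all) auto
    have u1X: "u1 @ m \<in> lists X" using less.prems uv by simp
    show ?thesis
    proof (cases "x = y")
      case True
      then have "u1 @ m \<approx> v1 @ m'" using sp by (simp add: splits_def)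
      then obtain c d where "reverses ?D u1 v1 c d" using less.hyps[of u1 m v1 m'] uv u1X by auto
      then show ?thesis using reverses_same[of ?D] True uv by blast
    next
      case False
      have "y \<in> X" using eqv_lists[OF less.prems(1)] less.prems(2) uv by simp
      then obtain a b where ab: "C x a y b" "is_rel F (x # a) (y # b)"
        using C_rel[OF _ _ False] less.prems(2) uv by auto
      obtain k where k: "u1 @ m \<approx> a @ k" "v1 @ m' \<approx> b @ k"
        using sp ab(1) unfolding splits_def by blast
      have lb: "length (b @ k) = length (u1 @ m)"
        using eqv_length[OF k(1)] C_length[OF ab(1)] by simp
      have bX: "b @ k \<in> lists X" using eqv_lists[OF k(1)] u1X C_X[OF ab(1)] by simp
      obtain c1 d1 where r1: "reverses ?D u1 a c1 d1"
        using less.hyps[OF _ k(1)] uv u1X by auto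
      obtain c2 d2 where r2: "reverses ?D b v1 c2 d2"
        using less.hyps[OF _ eqv_sym[OF k(2)]] uv lb bX by auto
      obtain k1 where k1: "m \<approx> c1 @ k1" "k \<approx> d1 @ k1"
        using reverses_complete[OF D[OF r1] k(1) u1X] by blast
      obtain k2 where k2: "k \<approx> c2 @ k2" "m' \<approx> d2 @ k2"
        using reverses_complete[OF D[OF r2] eqv_sym[OF k(2)] bX] by blast
      have "d1 @ k1 \<approx> c2 @ k2" using k1(2) k2(1) eqv_sym eqv_trans by blast
      moreover have "d1 @ k1 \<in> lists X" using eqv_lists[OF k1(2)] bX by simp
      moreover have "length (d1 @ k1) < length (u @ m)"
        using eqv_length[OF k1(2)] lb uv by simp
      ultimately obtain c3 d3 where r3: "reverses ?D d1 c2 c3 d3" using less.hyps by blast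
      have "?D x a y b" using ab by simp
      from reverses_diff[of ?D, OF this r1 r2 r3] show ?thesis using uv by blast
    qed
  qed
qed

lemma lcm_exists:
  assumes "u \<in> lists X" "v \<in> lists X" "m \<in> lists X" "u @ m \<approx> v @ m'"
  obtains c d where "c \<in> lists X" "d \<in> lists X" "u @ c \<approx> v @ d"
    "\<And>a b. a \<in> lists X \<Longrightarrow> u @ a \<approx> v @ b \<Longrightarrow> \<exists>k. a \<approx> c @ k \<and> b \<approx> d @ k"
proof -
  have "u @ m \<in> lists X" using assms by simp
  then obtain c d where "reverses (\<lambda>x u y v. C x u y v \<and> is_rel F (x # u) (y # v)) u v c d"
    using reverses_exists[OF assms(4)] by blast
  then have r: "reverses C u v c d" by (rule reverses_mono) blast
  show thesis
    by (rule that[of c d])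
      (use reverses_lists[OF r assms(1,2)] reverses_sound[OF r] reverses_complete[OF r] assms(1)
       in auto)
qed

section \<open>From words to the presented monoid\<close>

lemma rewrite_eqv:
  assumes "(rewrite_step F)\<^sup>*\<^sup>* u v" shows "u \<approx> v"
  using assms
proof (induction rule: rtranclp_induct)
  case (step v w)
  from step(2) have "v \<approx> w"
    by cases (auto intro!: eqv_append dest: F_sound)
  with step(3) show ?case by (rule eqv_trans)
qed simp

lemma eqv_rewrite:
  assumes "u \<approx> v" shows "(rewrite_step F)\<^sup>*\<^sup>* u v"
  using assms unfolding swap_eq_def
proof (induction rule: rtranclp_induct)
  case (step v w)
  from step(2) have "rewrite_step F v w"
    by cases (metis S_rel rewrite_step.intros)
  with step(3) show ?case by simp
qed simp

lemma word_eq_iff: "(u, v) \<in> word_eq X F \<longleftrightarrow> u \<in> lists X \<and> v \<in> lists X \<and> u \<approx> v"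
  using rewrite_eqv eqv_rewrite by (auto simp: word_eq_def)

lemma reversing_steps_context:
  assumes "(reversing_step F)\<^sup>*\<^sup>* s s'"
  shows "(reversing_step F)\<^sup>*\<^sup>* (a @ s @ b) (a @ s' @ b)"
  using assms
proof (induction rule: rtranclp_induct)
  case (step s' s'')
  from step(2) have "reversing_step F (a @ s' @ b) (a @ s'' @ b)"
  proof cases
    case (1 a' x b')
    then show ?thesis using reversing_step.intros(1)[of F "a @ a'" x "b' @ b"] by simp
  next
    case (2 x y u v a' b')
    then show ?thesis using reversing_step.intros(2)[of x y F u v "a @ a'" "b' @ b"] by simp
  qed
  with step(3) show ?case by simp
qed simp

lemma reverses_reversing_steps:
  assumes "reverses (\<lambda>x u y v. C x u y v \<and> is_rel F (x # u) (y # v)) u v c d"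
  shows "(reversing_step F)\<^sup>*\<^sup>* (map Neg (rev u) @ map Pos v) (map Pos c @ map Neg (rev d))"
  using assms
proof (induction rule: reverses.induct)
  case (reverses_same u v c d x)
  have "reversing_step F (map Neg (rev (x # u)) @ map Pos (x # v)) (map Neg (rev u) @ map Pos v)"
    using reversing_step.intros(1)[of F "map Neg (rev u)" x "map Pos v"] by simp
  then show ?case using reverses_same.IH by (rule converse_rtranclp_into_rtranclp)
next
  case (reverses_diff x a y b u c1 d1 v c2 d2 c3 d3)
  have "x \<noteq> y" using C_X reverses_diff.hyps(1) by blast
  then have "reversing_step F (map Neg (rev (x # u)) @ map Pos (y # v))
      (map Neg (rev u) @ map Pos a @ map Neg (rev b) @ map Pos v)"
    using reversing_step.intros(2)[of x y F a b "map Neg (rev u)" "map Pos v"]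
      reverses_diff.hyps(1) by simp
  also have "(reversing_step F)\<^sup>*\<^sup>* \<dots>
      (map Pos c1 @ map Neg (rev d1) @ map Neg (rev b) @ map Pos v)"
    using reversing_steps_context[OF reverses_diff.IH(1), of "[]" "map Neg (rev b) @ map Pos v"]
    by simp
  also have "(reversing_step F)\<^sup>*\<^sup>* \<dots>
      (map Pos c1 @ map Neg (rev d1) @ map Pos c2 @ map Neg (rev d2))"
    using reversing_steps_context[OF reverses_diff.IH(2), of "map Pos c1 @ map Neg (rev d1)" "[]"]
    by simp
  also have "(reversing_step F)\<^sup>*\<^sup>* \<dots>
      (map Pos c1 @ map Pos c3 @ map Neg (rev d3) @ map Neg (rev d2))"
    using reversing_steps_context[OF reverses_diff.IH(3), of "map Pos c1" "map Neg (rev d2)"]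
    by simp
  finally show ?case by simp
qed simp_all

theorem right_complete: "right_complete X F"
  unfolding right_complete_def
proof (clarify, goal_cases)
  case (1 u v)
  then have *: "u @ [] \<approx> v @ []" "u @ [] \<in> lists X" by (auto simp: word_eq_iff)
  then obtain c d where r: "reverses (\<lambda>x u y v. C x u y v \<and> is_rel F (x # u) (y # v)) u v c d"
    using reverses_exists by blast
  then have "reverses C u v c d" by (rule reverses_mono) blast
  \<comment> \<open>The equality u = v is a common multiple with empty remainders on both sides;
    these factor through \<open>c\<close> and \<open>d\<close>, which must then be empty.\<close>
  then have "c = []" "d = []"
    using reverses_complete[OF _ *] by (auto simp: eqv_Nil)
  then show ?case using reverses_reversing_steps[OF r] by simp
qed

abbreviation M where "M \<equiv> presented_monoid X F"

abbreviation cls where "cls u \<equiv> word_eq X F `` {u}"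

lemma equiv_word_eq: "equiv (lists X) (word_eq X F)"
proof (rule equivI)
  show "word_eq X F \<subseteq> lists X \<times> lists X" by (auto simp: word_eq_def)
  show "refl_on (lists X) (word_eq X F)" by (auto simp: refl_on_def word_eq_iff)
  show "sym (word_eq X F)" by (auto intro!: symI simp: word_eq_iff eqv_sym)
  show "trans (word_eq X F)" by (auto intro!: transI simp: word_eq_iff intro: eqv_trans)
qed

lemma carrier_cases:
  assumes "x \<in> carrier M" obtains u where "u \<in> lists X" "x = cls u"
proof -
  have "x \<in> lists X // word_eq X F" using assms by (simp add: presented_monoid_def)
  then show thesis using that by (rule quotientE)
qed

lemma cls_carrier: "u \<in> lists X \<Longrightarrow> cls u \<in> carrier M"
  by (auto simp: presented_monoid_def intro: quotientI)

lemma cls_eq: "u \<in> lists X \<Longrightarrow> v \<in> lists X \<Longrightarrow> cls u = cls v \<longleftrightarrow> u \<approx> v"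
  using eq_equiv_class_iff[OF equiv_word_eq] by (simp add: word_eq_iff)

lemma cls_mult:
  assumes "u \<in> lists X" "v \<in> lists X"
  shows "cls u \<otimes>\<^bsub>M\<^esub> cls v = cls (u @ v)"
proof -
  have *: "cls (u' @ v') = cls (u @ v)" if "u' \<in> cls u" "v' \<in> cls v" for u' v'
    using that assms eqv_append by (subst cls_eq) (auto simp: word_eq_iff eqv_sym)
  have ne: "u \<in> cls u" "v \<in> cls v" using assms by (simp_all add: word_eq_iff)
  have "cls u \<otimes>\<^bsub>M\<^esub> cls v = (\<Union>u'\<in>cls u. \<Union>v'\<in>cls v. cls (u' @ v'))"
    by (simp add: presented_monoid_def)
  also have "\<dots> = (\<Union>u'\<in>cls u. \<Union>v'\<in>cls v. cls (u @ v))"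
    using * by (intro SUP_cong refl)
  also have "\<dots> = cls (u @ v)" using ne by (metis UN_constant empty_iff)
  finally show ?thesis .
qed

theorem left_cancellative: "left_cancellative M"
  unfolding left_cancellative_def
proof (intro ballI impI)
  fix x y z assume "x \<in> carrier M" "y \<in> carrier M" "z \<in> carrier M" and e: "x \<otimes>\<^bsub>M\<^esub> y = x \<otimes>\<^bsub>M\<^esub> z"
  then obtain u v w where *: "u \<in> lists X" "x = cls u" "v \<in> lists X" "y = cls v"
      "w \<in> lists X" "z = cls w" by (metis carrier_cases)
  then have "u @ v \<approx> u @ w" using e by (simp add: cls_mult cls_eq)
  then show "y = z" using * eqv_cancel[of u v w] by (simp add: cls_eq)
qed

lemma cls_divides:
  assumes "u \<in> lists X" "v \<in> lists X"
  shows "cls u divides\<^bsub>M\<^esub> cls v \<longleftrightarrow> (\<exists>w\<in>lists X. u @ w \<approx> v)"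
proof
  assume "cls u divides\<^bsub>M\<^esub> cls v"
  then obtain c where c: "c \<in> carrier M" "cls v = cls u \<otimes>\<^bsub>M\<^esub> c" by (rule dividesE)
  then obtain w where "w \<in> lists X" "c = cls w" by (metis carrier_cases)
  moreover from this have "u @ w \<approx> v"
    using c assms cls_eq[of v "u @ w"] by (simp add: cls_mult eqv_sym)
  ultimately show "\<exists>w\<in>lists X. u @ w \<approx> v" by blast
next
  assume "\<exists>w\<in>lists X. u @ w \<approx> v"
  then obtain w where "w \<in> lists X" "u @ w \<approx> v" by blast
  then show "cls u divides\<^bsub>M\<^esub> cls v"
    using assms by (intro dividesI[of "cls w"]) (auto simp: cls_mult cls_eq eqv_sym cls_carrier)
qed

definition dv (infix "\<preceq>" 50) where "u \<preceq> v \<longleftrightarrow> (\<exists>w\<in>lists X. u @ w \<approx> v)"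

lemma dvI: "w \<in> lists X \<Longrightarrow> u @ w \<approx> v \<Longrightarrow> u \<preceq> v"
  unfolding dv_def by blast

lemma dv_trans: "u \<preceq> v \<Longrightarrow> v \<preceq> w \<Longrightarrow> u \<preceq> w"
proof -
  assume "u \<preceq> v" "v \<preceq> w"
  then obtain a b where *: "a \<in> lists X" "u @ a \<approx> v" "b \<in> lists X" "v @ b \<approx> w"
    by (auto simp: dv_def)
  have "u @ a @ b \<approx> w" using eqv_trans[OF eqv_append[OF *(2) eqv_refl] *(4)] by simp
  then show ?thesis using *(1,3) by (intro dvI[of "a @ b"]) auto
qed

lemma dv_length: "u \<preceq> v \<Longrightarrow> length u \<le> length v"
  by (auto simp: dv_def dest: eqv_length)

text \<open>This yields antisymmetry as true equality: mutual divisors have equal length.\<close>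

lemma dv_length_eq: "u \<preceq> v \<Longrightarrow> length v \<le> length u \<Longrightarrow> u \<approx> v"
proof -
  assume "u \<preceq> v" "length v \<le> length u"
  then obtain w where "u @ w \<approx> v" by (auto simp: dv_def)
  moreover from this have "length u + length w = length v"
    using eqv_length[of "u @ w" v] by simp
  then have "length w = 0" using \<open>length v \<le> length u\<close> by linarith
  ultimately show ?thesis by simp
qed

lemma dv_lcm:
  assumes "u \<in> lists X" "v \<in> lists X" "m \<in> lists X" "u \<preceq> m" "v \<preceq> m"
  obtains l where "l \<in> lists X" "u \<preceq> l" "v \<preceq> l" "\<And>m. u \<preceq> m \<Longrightarrow> v \<preceq> m \<Longrightarrow> l \<preceq> m"
proof -
  obtain a b where ab: "a \<in> lists X" "u @ a \<approx> m" "b \<in> lists X" "v @ b \<approx> m"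
    using assms by (auto simp: dv_def)
  then have "u @ a \<approx> v @ b" using eqv_sym eqv_trans by blast
  then obtain c d where cd: "c \<in> lists X" "d \<in> lists X" "u @ c \<approx> v @ d"
    "\<And>a b. a \<in> lists X \<Longrightarrow> u @ a \<approx> v @ b \<Longrightarrow> \<exists>k. a \<approx> c @ k \<and> b \<approx> d @ k"
    using lcm_exists[OF assms(1,2) ab(1)] by blast
  have "u @ c \<preceq> n" if n: "u \<preceq> n" "v \<preceq> n" for n
  proof -
    obtain a b where ab: "a \<in> lists X" "u @ a \<approx> n" "b \<in> lists X" "v @ b \<approx> n"
      using n by (auto simp: dv_def)
    then have "u @ a \<approx> v @ b" using eqv_sym eqv_trans by blast
    then obtain k where k: "a \<approx> c @ k" using cd(4)[OF ab(1)] by blast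
    have "u @ c @ k \<approx> n" using eqv_trans[OF eqv_append[OF eqv_refl eqv_sym[OF k]] ab(2)] .
    moreover have "k \<in> lists X" using eqv_lists[OF k] ab(1) by simp
    ultimately show ?thesis using dvI[of k "u @ c" n] by simp
  qed
  moreover have "u \<preceq> u @ c" "v \<preceq> u @ c"
    using cd(1-3) eqv_sym by (auto simp: dv_def)
  ultimately show thesis using that[of "u @ c"] assms(1) cd(1) by auto
qed

text \<open>A common divisor of maximal length works. Its lcm with any other common divisor again
  divides \<open>u\<close> and \<open>v\<close>, so it cannot be longer and is congruent to
  it.\<close>

lemma dv_gcd:
  assumes "u \<in> lists X" "v \<in> lists X"
  obtains g where "g \<in> lists X" "g \<preceq> u" "g \<preceq> v"
    "\<And>d. d \<in> lists X \<Longrightarrow> d \<preceq> u \<Longrightarrow> d \<preceq> v \<Longrightarrow> d \<preceq> g"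
proof -
  let ?P = "\<lambda>g. g \<in> lists X \<and> g \<preceq> u \<and> g \<preceq> v"
  have "[] \<preceq> w" if "w \<in> lists X" for w using that by (auto simp: dv_def)
  then have "?P []" using assms by simp
  moreover have "\<forall>g. ?P g \<longrightarrow> length g < Suc (length u)" using dv_length by fastforce
  ultimately obtain g where g: "?P g" "\<forall>d. ?P d \<longrightarrow> length d \<le> length g"
    using ex_has_greatest_nat[of ?P "[]" length "Suc (length u)"] by blast
  have "d \<preceq> g" if d: "?P d" for d
  proof -
    obtain l where l: "l \<in> lists X" "g \<preceq> l" "d \<preceq> l" "\<And>m. g \<preceq> m \<Longrightarrow> d \<preceq> m \<Longrightarrow> l \<preceq> m"
      using dv_lcm[of g d u] g(1) d assms(1) by blast
    then have "?P l" using g(1) d by blast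
    then have "g \<approx> l" using dv_length_eq[OF l(2)] g(2) by blast
    then have "l \<preceq> g" using dvI[of "[]" l g] eqv_sym by simp
    then show ?thesis using l(3) dv_trans by blast
  qed
  then show thesis using that g(1) by blast
qed

text \<open>Only joins need the hypothesis \<open>common\<close>; meets come from
  \<open>dv_gcd\<close>, where \<open>u\<close> itself bounds the lcms.\<close>

theorem lattice_left_division:
  assumes common: "\<And>u v. u \<in> lists X \<Longrightarrow> v \<in> lists X \<Longrightarrow> \<exists>m\<in>lists X. u \<preceq> m \<and> v \<preceq> m"
  shows "lattice (left_division_order M)"
proof -
  let ?L = "left_division_order M"
  have L [simp]: "carrier ?L = carrier M" "(.=\<^bsub>?L\<^esub>) = (=)" "(\<sqsubseteq>\<^bsub>?L\<^esub>) = (divides\<^bsub>M\<^esub>)"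
    by (auto simp: left_division_order_def)
  have dvd: "cls u divides\<^bsub>M\<^esub> cls v \<longleftrightarrow> u \<preceq> v" if "u \<in> lists X" "v \<in> lists X" for u v
    using that by (simp add: cls_divides dv_def)
  have po: "partial_order ?L"
  proof (unfold_locales, goal_cases)
    case (4 x)
    then obtain u where "u \<in> lists X" "x = cls u" by (auto elim: carrier_cases)
    moreover have "u \<preceq> u" by (auto simp: dv_def intro!: bexI[of _ "[]"])
    ultimately show ?case by (simp add: dvd)
  next
    case (5 x y)
    then obtain u v where *: "u \<in> lists X" "x = cls u" "v \<in> lists X" "y = cls v"
      by (metis carrier_cases L(1))
    then have "u \<preceq> v" "v \<preceq> u" using 5 by (auto simp: dvd)
    then show ?case using dv_length_eq dv_length * by (simp add: cls_eq)
  next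
    case (6 x y z)
    then obtain u v w where *: "u \<in> lists X" "x = cls u" "v \<in> lists X" "y = cls v"
      "w \<in> lists X" "z = cls w" by (metis carrier_cases L(1))
    then show ?case using 6 dv_trans by (auto simp: dvd)
  qed auto
  interpret partial_order ?L by (rule po)
  show ?thesis
  proof (unfold_locales, goal_cases)
    case (1 x y)
    then have xy: "x \<in> carrier M" "y \<in> carrier M" by simp_all
    then obtain u v where *: "u \<in> lists X" "x = cls u" "v \<in> lists X" "y = cls v"
      by (metis carrier_cases L(1))
    obtain l where l: "l \<in> lists X" "u \<preceq> l" "v \<preceq> l" "\<And>m. u \<preceq> m \<Longrightarrow> v \<preceq> m \<Longrightarrow> l \<preceq> m"
      using dv_lcm[OF *(1,3)] common[OF *(1,3)] by metis
    have "cls l \<sqsubseteq>\<^bsub>?L\<^esub> z"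
      if z: "z \<in> carrier M" "x \<sqsubseteq>\<^bsub>?L\<^esub> z" "y \<sqsubseteq>\<^bsub>?L\<^esub> z" for z
    proof -
      obtain w where "w \<in> lists X" "z = cls w" using carrier_cases z(1) by metis
      then show ?thesis using z l * by (simp add: dvd)
    qed
    then have 1: "cls l \<sqsubseteq>\<^bsub>?L\<^esub> z" if "z \<in> Upper ?L {x, y}" for z
      using that xy by (auto simp: Upper_def)
    have 2: "z \<sqsubseteq>\<^bsub>?L\<^esub> cls l" if "z \<in> {x, y}" for z
      using that dvd[OF *(1) l(1)] dvd[OF *(3) l(1)] l(2,3) *(2,4) by auto
    have "least ?L (cls l) (Upper ?L {x, y})"
      using xy l(1) by (intro least_UpperI[OF 2 1]) (simp_all add: cls_carrier)
    then show ?case by blast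
  next
    case (2 x y)
    then have xy: "x \<in> carrier M" "y \<in> carrier M" by simp_all
    then obtain u v where *: "u \<in> lists X" "x = cls u" "v \<in> lists X" "y = cls v"
      by (metis carrier_cases L(1))
    obtain g where g: "g \<in> lists X" "g \<preceq> u" "g \<preceq> v"
        "\<And>d. d \<in> lists X \<Longrightarrow> d \<preceq> u \<Longrightarrow> d \<preceq> v \<Longrightarrow> d \<preceq> g"
      using dv_gcd[OF *(1,3)] by metis
    have "z \<sqsubseteq>\<^bsub>?L\<^esub> cls g"
      if z: "z \<in> carrier M" "z \<sqsubseteq>\<^bsub>?L\<^esub> x" "z \<sqsubseteq>\<^bsub>?L\<^esub> y" for z
    proof -
      obtain w where "w \<in> lists X" "z = cls w" using carrier_cases z(1) by metis
      then show ?thesis using z g * by (simp add: dvd)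
    qed
    then have 1: "z \<sqsubseteq>\<^bsub>?L\<^esub> cls g" if "z \<in> Lower ?L {x, y}" for z
      using that xy by (auto simp: Lower_def)
    have 2: "cls g \<sqsubseteq>\<^bsub>?L\<^esub> z" if "z \<in> {x, y}" for z
      using that dvd[OF g(1) *(1)] dvd[OF g(1) *(3)] g(2,3) *(2,4) by auto
    have "greatest ?L (cls g) (Lower ?L {x, y})"
      using xy g(1) by (intro greatest_LowerI[OF 2 1]) (simp_all add: cls_carrier)
    then show ?case by blast
  qed
qed

text \<open>Powers of a quasi-central common multiple of the generators are common multiples of all
  words.\<close>

lemma common_multiples:
  assumes \<delta>: "\<delta> \<in> lists X" and div: "\<And>x. x \<in> X \<Longrightarrow> [x] \<preceq> \<delta>"
    and shift: "\<And>x. x \<in> X \<Longrightarrow> \<exists>y\<in>X. x # \<delta> \<approx> \<delta> @ [y]"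
    and uv: "u \<in> lists X" "v \<in> lists X"
  shows "\<exists>m\<in>lists X. u \<preceq> m \<and> v \<preceq> m"
proof -
  define P where "P k = concat (replicate k \<delta>)" for k
  have PX: "P k \<in> lists X" for k using \<delta> by (induction k) (auto simp: P_def)
  have Psuc: "P (Suc k) = P k @ \<delta>" for k
    by (simp add: P_def flip: replicate_append_same)
  have Pshift: "\<exists>y\<in>X. x # P k \<approx> P k @ [y]" if "x \<in> X" for x k
  proof (induction k)
    case 0
    then show ?case using that by (auto simp: P_def)
  next
    case (Suc k)
    then obtain y where y: "y \<in> X" "x # P k \<approx> P k @ [y]" by blast
    obtain y' where y': "y' \<in> X" "y # \<delta> \<approx> \<delta> @ [y']" using shift y(1) by blast
    have "x # P (Suc k) \<approx> P k @ y # \<delta>"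
      using eqv_append[OF y(2) eqv_refl[of \<delta>]] by (simp add: Psuc)
    also have "\<dots> \<approx> P (Suc k) @ [y']"
      using eqv_append[OF eqv_refl[of "P k"] y'(2)] by (simp add: Psuc)
    finally show ?case using y'(1) by blast
  qed
  have dvP: "w \<preceq> P (length w)" if "w \<in> lists X" for w
    using that
  proof (induction w)
    case Nil
    then show ?case by (auto simp: dv_def P_def)
  next
    case (Cons x w)
    then obtain a where a: "a \<in> lists X" "w @ a \<approx> P (length w)" by (auto simp: dv_def)
    \<comment> \<open>The letter \<open>x\<close> passes the power of \<delta> and becomes
      \<open>y\<close>; the word \<open>b\<close> completes \<open>y\<close> to one further factor
      \<delta>.\<close>
    obtain y where y: "y \<in> X" "x # P (length w) \<approx> P (length w) @ [y]"
      using Pshift Cons.hyps by blast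
    obtain b where b: "b \<in> lists X" "[y] @ b \<approx> \<delta>" using div[OF y(1)] by (auto simp: dv_def)
    have "(x # w) @ a @ b \<approx> x # P (length w) @ b"
      using eqv_Cons[OF eqv_append[OF a(2) eqv_refl[of b]]] by simp
    also have "\<dots> \<approx> P (length w) @ [y] @ b"
      using eqv_append[OF y(2) eqv_refl[of b]] by simp
    also have "\<dots> \<approx> P (length (x # w))"
      using eqv_append[OF eqv_refl b(2)] by (simp add: Psuc)
    finally show ?case using a(1) b(1) by (intro dvI[of "a @ b"]) auto
  qed
  have mono: "P k \<preceq> P (k + l)" for k l
    using PX by (intro dvI[of "P l"]) (auto simp: P_def replicate_add)
  have "u \<preceq> P (length u + length v)" "v \<preceq> P (length v + length u)"
    using dv_trans[OF dvP mono] uv by auto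
  then show ?thesis using PX by (metis add.commute)
qed

end

section \<open>Complements of generators\<close>

text \<open>The cyclic order of three subscripts without the modulus: one of the three rotations is
  increasing. It depends only on the order of the naturals, hence is preserved by increasing
  renamings.\<close>

definition co :: "nat \<Rightarrow> nat \<Rightarrow> nat \<Rightarrow> bool" where
  "co p q r \<longleftrightarrow> p < q \<and> q < r \<or> q < r \<and> r < p \<or> r < p \<and> p < q"

lemma co_rot: "co p q r \<Longrightarrow> co q r p"
  and co_asym: "co p q r \<Longrightarrow> \<not> co p r q"
  and co_total: "p \<noteq> q \<Longrightarrow> q \<noteq> r \<Longrightarrow> p \<noteq> r \<Longrightarrow> co p q r \<or> co p r q"
  by (auto simp: co_def)

lemma co_trans: "co p q r \<Longrightarrow> co p r s \<Longrightarrow> co p q s \<and> co q r s"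
  by (auto simp: co_def)

text \<open>An exponent structure \<open>(up, dn, j)\<close> supplies the successor and the predecessor of
  exponents and the exponent \<open>j\<close> used to write $t_p$. The complements only use this structure
  and the order of the subscripts, which makes it possible to compute them with a few
  subscripts and exponents.\<close>

type_synonym exps = "(nat \<Rightarrow> nat) \<times> (nat \<Rightarrow> nat) \<times> nat"

fun tword :: "exps \<Rightarrow> nat \<Rightarrow> gen list" where
  "tword (up, dn, j) p = [E p (up j), E p j]"

text \<open>Together with \<open>prv\<close>, the partner letters of R5: \<open>nxt\<close> carries
  a_p^(i) forward across a_pq, and \<open>prv\<close> carries a_p^(i) back across a_qp.\<close>

fun nxt :: "exps \<Rightarrow> nat \<Rightarrow> nat \<Rightarrow> nat \<Rightarrow> gen" where
  "nxt (up, dn, j) p i q = E q (if p < q then i else up i)"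

fun prv :: "exps \<Rightarrow> nat \<Rightarrow> nat \<Rightarrow> nat \<Rightarrow> gen" where
  "prv (up, dn, j) p i q = E q (if q < p then i else dn i)"

text \<open>For p < q. The three cases are R5 for (p,q), R5 for (q,p) with its exponent shift, and
  C6 for all other exponents.\<close>

fun complementE :: "exps \<Rightarrow> nat \<Rightarrow> nat \<Rightarrow> nat \<Rightarrow> nat \<Rightarrow> gen list \<times> gen list" where
  "complementE (up, dn, _) p i q j =
    (if i = j then ([A p q], [E p i])
     else if up j = i then ([E q j], [A q p])
     else ([E p (dn i), A p q], [E q (dn j), A q p]))"

text \<open>\<open>complement s x y = (u, v)\<close> gives the relation $xu = yv$.\<close>

fun complement :: "exps \<Rightarrow> gen \<Rightarrow> gen \<Rightarrow> gen list \<times> gen list" where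
  "complement s (A p q) (A r u) =
    (if q = r then
       (if p = u then (tword s q, tword s p)
        else if co p q u then ([A q u], [A p u]) else (A p u # tword s q, A q p # tword s u))
     else if p = u then
       (if co r u q then ([A r q], [A u q]) else (A u r # tword s q, A r q # tword s u))
     else if q = u then
       (if co p r q then ([A p r], [A p q]) else ([A r q], [A r p]))
     else if p = r then
       (if co p q u then ([A q u], [A p q]) else ([A p u], [A u q]))
     else if co p r q then
       (if co q u p then ([A p r, A q u], [A p u, A r q])
        else if co p r u then ([A r u], [A p q])
        else (A p u # A u r # tword s q, A r p # A r q # tword s u))
     else if co p u q then ([A r q, A p u], [A r p, A u q])
     else ([A r u], [A p q]))"
| "complement s (A p q) (E r i) =
    (if r = q then ([E r i], [prv s q i p])
     else if r = p then ([nxt s p i q], [A p q])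
     else if co p q r then ([E r i], [A p q])
     else ([A p r, nxt s r i q], [A r q, prv s r i p]))"
| "complement s (E r i) (A p q) =
    (if r = q then ([prv s q i p], [E r i])
     else if r = p then ([A p q], [nxt s p i q])
     else if co p q r then ([A p q], [E r i])
     else ([A r q, prv s r i p], [A p r, nxt s r i q]))"
| "complement s (E p i) (E q j) =
    (if p = q then ([E p (fst (snd s) i)], [E p (fst (snd s) j)])
     else if p < q then complementE s p i q j
     else prod.swap (complementE s q j p i))"

text \<open>The pairs of generators whose relation is one of a set of length two relations that
  generate the congruence.\<close>

fun adj :: "exps \<Rightarrow> gen \<Rightarrow> gen \<Rightarrow> bool" where
  "adj s (E p i) (E q j) = (p = q \<and> (fst s i = j \<or> fst s j = i))"
| "adj s (A p q) (A r u) = (p \<noteq> r)"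
| "adj s _ _ = True"

section \<open>The relations\<close>

locale braid_presentation =
  fixes e n :: nat
  assumes e: "e \<ge> 1"
begin

definition up where "up i = Suc i mod e"
definition dn where "dn i = (i + (e - 1)) mod e"

abbreviation std :: "nat \<Rightarrow> exps" where "std j \<equiv> (up, dn, j)"

lemma dn_up [simp]: "i < e \<Longrightarrow> dn (up i) = i"
proof -
  assume "i < e"
  have "dn (up i) = (Suc i + (e - 1)) mod e" unfolding up_def dn_def by (rule mod_add_left_eq)
  also have "\<dots> = i" using e \<open>i < e\<close> by simp
  finally show ?thesis .
qed

lemma up_dn [simp]: "i < e \<Longrightarrow> up (dn i) = i"
proof -
  assume "i < e"
  have "up (dn i) = Suc (i + (e - 1)) mod e" unfolding up_def dn_def by (rule mod_Suc_eq)
  also have "\<dots> = i" using e \<open>i < e\<close> by simp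
  finally show ?thesis .
qed

lemma up_less [simp]: "up i < e" and dn_less [simp]: "dn i < e"
  using e by (simp_all add: up_def dn_def)

abbreviation G where "G \<equiv> gens e n"

text \<open>Taking \<open>std 0\<close> is no restriction: t_p has two letters and never occurs in a
  complement of length one.\<close>

definition gstep where
  "gstep z g y h \<longleftrightarrow> z \<in> G \<and> y \<in> G \<and> z \<noteq> y \<and> adj (std 0) z y \<and> complement (std 0) z y = ([g], [h])"

text \<open>Here \<open>j\<close> must range over all exponents, because the image of a model may
  place the base exponent of t_p anywhere on the cycle.\<close>

definition gcomp where
  "gcomp x u y v \<longleftrightarrow> x \<in> G \<and> y \<in> G \<and> x \<noteq> y \<and> (\<exists>j<e. complement (std j) x y = (u, v))"

lemma A_G [simp]: "A p q \<in> G \<longleftrightarrow> p < n \<and> q < n \<and> p \<noteq> q"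
  and E_G [simp]: "E p i \<in> G \<longleftrightarrow> p < n \<and> i < e"
  by (auto simp: gens_def)

lemma G_cases:
  assumes "x \<in> G"
  obtains p q where "x = A p q" "p < n" "q < n" "p \<noteq> q" | p i where "x = E p i" "p < n" "i < e"
  using assms by (auto simp: gens_def)

lemma complement_lists:
  assumes "x \<in> G" "y \<in> G" "x \<noteq> y" "complement (std j) x y = (u, v)" "j < e"
  shows "u \<in> lists G \<and> v \<in> lists G"
  using assms(1)
proof (cases rule: G_cases)
  case x: (1 p q)
  from assms(2) show ?thesis
    by (cases rule: G_cases) (use x assms(3-5) in \<open>auto split: if_splits\<close>)
next
  case x: (2 p i)
  from assms(2) show ?thesis
    by (cases rule: G_cases) (use x assms(3-5) in \<open>auto split: if_splits\<close>)
qed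

text \<open>The cases follow the tests in \<open>complement\<close>. With four distinct subscripts,
  single-letter complements occur only for non-crossing pairs, which commute; the transitivity of
  \<open>co\<close> shows that the exchanged pair is recognized as non-crossing too.\<close>

lemma complement_AA_swap:
  assumes ne: "p \<noteq> q" "r \<noteq> u" "p \<noteq> r \<or> q \<noteq> u" and c: "complement s (A p q) (A r u) = ([g], [h])"
  shows "complement s (A r u) (A p q) = ([h], [g])"
proof -
  have [simp]: "tword s p \<noteq> [x]" for p x by (cases s) simp
  consider "q = r" | "q \<noteq> r" "p = u" | "q \<noteq> r" "p \<noteq> u" "q = u" | "q \<noteq> r" "p \<noteq> u" "q \<noteq> u" "p = r"
    | "q \<noteq> r" "p \<noteq> u" "q \<noteq> u" "p \<noteq> r" by blast
  then show ?thesis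
  proof cases
    case 1
    then show ?thesis using ne c by (cases "p = u"; cases "co p q u") auto
  next
    case 2
    then show ?thesis using ne c by (cases "co r u q") auto
  next
    case 3
    then have "co p r q \<longleftrightarrow> \<not> co r p q" using ne co_rot co_asym co_total by metis
    then show ?thesis using ne c 3 by (cases "co p r q") auto
  next
    case 4
    then have "co p q u \<longleftrightarrow> \<not> co p u q" using ne co_rot co_asym co_total by metis
    then show ?thesis using ne c 4 by (cases "co p q u") auto
  next
    case 5
    show ?thesis
    proof (cases "co p r q")
      case True
      then have *: "\<not> co q u p" "co p r u" using c ne 5
        by (cases "co q u p"; cases "co p r u"; simp)+
      then have "co p u q" using co_total[of p u q] co_rot[of p q u] ne 5 by blast
      then have "\<not> co r p u" "\<not> co r q u" using co_trans[OF *(2)] co_rot[OF *(2)] co_asym by blast+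
      then show ?thesis using c ne 5 True * by auto
    next
      case False
      then have *: "\<not> co p u q" using c ne 5 by (cases "co p u q") simp_all
      then have pq: "co p q u" "co p q r" using False co_total ne 5 by metis+
      show ?thesis
      proof (cases "co r p u")
        case True
        have "co q u r" using co_trans[OF pq(1)] co_rot[OF True] by blast
        then have "\<not> co u q r" "co r p q" using co_rot co_asym pq(2) by blast+
        then show ?thesis using c ne 5 False * True by auto
      next
        case rpu: False
        then have "co p r u" using co_total[of p r u] co_rot[of p u r] co_rot[of u r p] ne 5 by blast
        then have "\<not> co r q u" using co_trans[OF pq(2)] co_rot co_asym by blast
        then show ?thesis using c ne 5 False * rpu by auto
      qed
    qed
  qed
qed

lemma complement_swap:
  assumes "x \<in> G" "y \<in> G" "x \<noteq> y" "complement (std j) x y = ([g], [h])"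
  shows "complement (std j) y x = ([h], [g])"
  using assms(1)
proof (cases rule: G_cases)
  case x: (1 p q)
  from assms(2) show ?thesis
  proof (cases rule: G_cases)
    case y: (1 r u)
    then show ?thesis using complement_AA_swap x assms(3,4) by auto
  qed (use x assms(3-4) in \<open>auto split: if_splits\<close>)
next
  case x: (2 p i)
  from assms(2) show ?thesis
    by (cases rule: G_cases) (use x assms(3-4) in \<open>auto split: if_splits\<close>)
qed

lemma adj_sym: "adj s x y \<Longrightarrow> adj s y x"
  by (cases x; cases y) auto

sublocale swap_presentation G gstep
proof
  fix z g y h assume *: "gstep z g y h"
  then show "z \<in> G \<and> g \<in> G \<and> y \<in> G \<and> h \<in> G \<and> z \<noteq> y"
    using complement_lists[of z y 0 "[g]" "[h]"] e by (auto simp: gstep_def)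
  from * show "gstep y h z g"
    using complement_swap adj_sym by (auto simp: gstep_def)
qed

notation eqv (infix "\<approx>" 50)

section \<open>Deriving the consequences from the swaps alone\<close>

lemma gstepI:
  assumes "z \<in> G" "y \<in> G" "z \<noteq> y" "adj (std 0) z y" "complement (std 0) z y = ([g], [h])"
  shows "[z, g] \<approx> [y, h]"
  using assms eqv_S[of z g y h "[]"] by (simp add: gstep_def)

lemma eqv_in: "u \<approx> v \<Longrightarrow> a @ u @ b \<approx> a @ v @ b"
  by (intro eqv_append eqv_refl)

lemma eqv_R1:
  assumes "co p q r" "co p r s" "p < n" "q < n" "r < n" "s < n"
  shows "[A p q, A r s] \<approx> [A r s, A p q]"
  using assms by (intro gstepI) (auto simp: co_def)

lemma eqv_R2:
  assumes "co p q r" "co p r s" "p < n" "q < n" "r < n" "s < n"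
  shows "[A p s, A q r] \<approx> [A q r, A p s]"
  using assms by (intro gstepI) (auto simp: co_def)

lemma eqv_R3a:
  assumes "co p q r" "p < n" "q < n" "r < n"
  shows "[A p q, A q r] \<approx> [A q r, A p r]"
  using assms by (intro gstepI) (auto simp: co_def)

lemma eqv_R3b:
  assumes "co p q r" "p < n" "q < n" "r < n"
  shows "[A q r, A p r] \<approx> [A p r, A p q]"
  using assms by (intro gstepI) (auto simp: co_def)

lemma eqv_R4:
  assumes "co p q r" "p < n" "q < n" "r < n" "k < e"
  shows "[A p q, E r k] \<approx> [E r k, A p q]"
  using assms by (intro gstepI) (auto simp: co_def)

text \<open>The exponent rule of R5: a_p^(k) a_pq = a_pq a_q^(step p q k). A round trip from p to q
  and back passes the end of the index range once and so raises the exponent by one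
  (\<open>step_step\<close>); a detour through an intermediate point of the cyclic order costs
  nothing (\<open>step_co\<close>).\<close>

definition step :: "nat \<Rightarrow> nat \<Rightarrow> nat \<Rightarrow> nat" where "step p q k = (if p < q then k else up k)"

lemma step_less [simp]: "k < e \<Longrightarrow> step p q k < e"
  by (simp add: step_def)

lemma step_step: "p \<noteq> q \<Longrightarrow> step q p (step p q k) = up k"
  by (auto simp: step_def)

lemma step_up: "step p q (up k) = up (step p q k)"
  by (simp add: step_def)

lemma step_co: "co p q r \<Longrightarrow> step q r (step p q k) = step p r k"
  by (auto simp: step_def co_def)

lemma eqv_R5a:
  assumes "p < n" "q < n" "p \<noteq> q" "k < e"
  shows "[A p q, E q (step p q k)] \<approx> [E q (step p q k), E p k]"
  using assms by (intro gstepI) (auto simp: step_def)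

lemma eqv_R5b:
  assumes "p < n" "q < n" "p \<noteq> q" "k < e"
  shows "[A p q, E q (step p q k)] \<approx> [E p k, A p q]"
  using assms by (intro eqv_sym[OF gstepI]) (auto simp: step_def)

definition T where "T p k = [E p (up k), E p k]"

lemma T_up:
  assumes "p < n" "k < e"
  shows "T p (up k) \<approx> T p k"
proof (cases "up (up k) = up k")
  \<comment> \<open>This is the degenerate cycle e = 1, where the two words coincide and there is no
    swap between distinct letters.\<close>
  case True
  then have "up k = k" using assms dn_up[of "up k"] dn_up[of k] by simp
  then show ?thesis by (simp add: T_def)
next
  case False
  then show ?thesis unfolding T_def using assms by (intro gstepI) auto
qed

lemma T_eq:
  assumes "p < n" "k < e" "l < e"
  shows "T p k \<approx> T p l"
proof -
  have "T p k \<approx> T p 0" if "k < e" for k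
    using that
  proof (induction k)
    case (Suc k)
    then have "up k = Suc k" by (simp add: up_def)
    then show ?case using T_up[of p k] Suc assms(1) eqv_trans by auto
  qed simp
  then show ?thesis using assms(2,3) eqv_sym eqv_trans by blast
qed

text \<open>The letters of t_p are passed one at a time. The inner one turns a_pq into a_q^(j); the
  outer one, whose exponent is raised by the round trip p, q, p, turns that into a_qp.\<close>

lemma T_left:
  assumes "p < n" "q < n" "p \<noteq> q" "k < e"
  shows "T p k @ [A p q] \<approx> A q p # T p k"
proof -
  have "[E p (up k), E p k, A p q] \<approx> [E p (up k), E q (step p q k), E p k]"
    using eqv_in[OF eqv_trans[OF eqv_sym[OF eqv_R5b] eqv_R5a], of p q k "[E p (up k)]" "[]"] assms by simp
  also have "\<dots> \<approx> [A q p, E p (up k), E p k]"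
    using eqv_in[OF eqv_sym[OF eqv_R5a], of q p "step p q k" "[]" "[E p k]"] assms
    by (simp add: step_step)
  finally show ?thesis by (simp add: T_def)
qed

lemma T_right:
  assumes "p < n" "q < n" "p \<noteq> q" "k < e"
  shows "T p k @ [A p q] \<approx> A p q # T q (step p q k)"
proof -
  have "[E p (up k), E p k, A p q] \<approx> [E p (up k), A p q, E q (step p q k)]"
    using eqv_in[OF eqv_sym[OF eqv_R5b], of p q k "[E p (up k)]" "[]"] assms by simp
  also have "\<dots> \<approx> [A p q, E q (up (step p q k)), E q (step p q k)]"
    using eqv_in[OF eqv_sym[OF eqv_R5b], of p q "up k" "[]" "[E q (step p q k)]"] assms
    by (simp add: step_up)
  finally show ?thesis by (simp add: T_def)
qed

lemma T_comm:
  assumes "co p q r" "p < n" "q < n" "r < n" "k < e"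
  shows "T r k @ [A p q] \<approx> A p q # T r k"
proof -
  have "[E r (up k), E r k, A p q] \<approx> [E r (up k), A p q, E r k]"
    using eqv_in[OF eqv_sym[OF eqv_R4], of p q r k "[E r (up k)]" "[]"] assms by simp
  also have "\<dots> \<approx> [A p q, E r (up k), E r k]"
    using eqv_in[OF eqv_sym[OF eqv_R4], of p q r "up k" "[]" "[E r k]"] assms by simp
  finally show ?thesis by (simp add: T_def)
qed

lemma A_T:
  assumes "p < n" "q < n" "p \<noteq> q" "k < e" "l < e"
  shows "A p q # T q k \<approx> T p l @ [A p q]"
proof -
  have "A p q # T q k \<approx> A p q # T q (step p q l)"
    using T_eq assms by (intro eqv_Cons) simp
  also have "\<dots> \<approx> T p l @ [A p q]" using T_right assms eqv_sym by blast
  finally show ?thesis .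
qed

lemma T_swap:
  assumes "p < n" "q < n" "p \<noteq> q" "k < e" "l < e"
  shows "T p k @ [A p q] \<approx> T q l @ [A q p]"
proof -
  have "T p k @ [A p q] \<approx> A p q # T q l" using A_T eqv_sym assms by blast
  also have "\<dots> \<approx> T q l @ [A q p]" using T_left[of q p l] assms eqv_sym by simp
  finally show ?thesis .
qed

lemma eqv_C5:
  assumes "p < n" "q < n" "p \<noteq> q" "k < e" "l < e"
  shows "A p q # T q k \<approx> A q p # T p l"
proof -
  have "A p q # T q k \<approx> T p l @ [A p q]" using A_T assms by simp
  also have "\<dots> \<approx> A q p # T p l" using T_left assms by simp
  finally show ?thesis .
qed

lemma eqv_C1:
  assumes "co p q r" "co p r s" "p < n" "q < n" "r < n" "s < n"
  shows "[A p r, A p q, A r s] \<approx> [A q s, A p s, A q r]"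
proof -
  have co: "co p r s" "co q r s" using assms(1,2) by (auto simp: co_def)
  have "[A p r, A p q, A r s] \<approx> [A q r, A p r, A r s]"
    using eqv_in[OF eqv_sym[OF eqv_R3b], of p q r "[]" "[A r s]"] assms by simp
  also have "\<dots> \<approx> [A q r, A r s, A p s]"
    using eqv_in[OF eqv_R3a, of p r s "[A q r]" "[]"] assms co by simp
  also have "\<dots> \<approx> [A q s, A q r, A p s]"
    using eqv_in[OF eqv_trans[OF eqv_R3a eqv_R3b], of q r s "[]" "[A p s]"] assms co by simp
  also have "\<dots> \<approx> [A q s, A p s, A q r]"
    using eqv_in[OF eqv_sym[OF eqv_R2], of p q r s "[A q s]" "[]"] assms by simp
  finally show ?thesis .
qed

lemma eqv_C4:
  assumes "co p q r" "p < n" "q < n" "r < n" "k < e"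
  shows "[A p r, A p q, E r (step p r k)] \<approx> [E q (step p q k), A q r, E p k]"
proof -
  have "[A p r, A p q, E r (step p r k)] \<approx> [A q r, A p r, E r (step p r k)]"
    using eqv_in[OF eqv_sym[OF eqv_R3b], of p q r "[]" "[E r (step p r k)]"] assms by simp
  also have "\<dots> \<approx> [A q r, E r (step p r k), E p k]"
    using eqv_in[OF eqv_R5a, of p r k "[A q r]" "[]"] assms by (auto simp: co_def)
  also have "\<dots> \<approx> [E q (step p q k), A q r, E p k]"
    using eqv_in[OF eqv_R5b, of q r "step p q k" "[]" "[E p k]"] assms step_co[OF assms(1)]
    by (auto simp: co_def)
  finally show ?thesis .
qed

text \<open>\<open>eqv_C4\<close> and R5 pull the two letters of t_r to the front, where they form
  t_q. This passes a_qp as t_p, which commutes with a_qr.\<close>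

lemma eqv_C3:
  assumes "co p q r" "p < n" "q < n" "r < n" "k < e" "l < e"
  shows "[A p r, A p q] @ T r k \<approx> [A q p, A q r] @ T p l"
proof -
  let ?r = "step p r l" and ?q = "step p q l"
  have ne: "p \<noteq> q" "p \<noteq> r" "q \<noteq> r" using assms(1) by (auto simp: co_def)
  have co: "co q r p" using assms(1) by (auto simp: co_def)
  have "[A p r, A p q] @ T r k \<approx> [A p r, A p q] @ T r ?r"
    using T_eq assms by (intro eqv_append eqv_refl) simp
  also have "\<dots> \<approx> [E q (up ?q), A q r, E p (up l), E r ?r]"
    using eqv_in[OF eqv_C4, of p q r "up l" "[]" "[E r ?r]"] assms by (simp add: step_up T_def)
  also have "\<dots> \<approx> [E q (up ?q), A q r, E r ?r, A r p]"
    using eqv_in[OF eqv_trans[OF eqv_sym[OF eqv_R5a] eqv_R5b], of r p ?r "[E q (up ?q), A q r]" "[]"] assms ne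
    by (simp add: step_step)
  also have "\<dots> \<approx> [E q (up ?q), E q ?q, A q r, A r p]"
    using eqv_in[OF eqv_R5b, of q r ?q "[E q (up ?q)]" "[A r p]"] assms ne step_co[OF assms(1)] by simp
  also have "\<dots> \<approx> T q ?q @ [A q p, A q r]"
    using eqv_in[OF eqv_trans[OF eqv_R3a eqv_R3b], of q r p "T q ?q" "[]"] assms co by (simp add: T_def)
  also have "\<dots> \<approx> A q p # T p l @ [A q r]"
    using eqv_in[OF eqv_sym[OF A_T], of q p l ?q "[]" "[A q r]"] assms ne by simp
  also have "\<dots> \<approx> [A q p, A q r] @ T p l"
    using eqv_in[OF T_comm, of q r p l "[A q p]" "[]"] assms co by simp
  finally show ?thesis .
qed

text \<open>Commutations and R3 bring a_rs next to t_s, and passing it turns t_s into t_r. This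
  leaves an instance of \<open>eqv_C3\<close> for r, p, q, after which a_rs passes t_q
  unchanged.\<close>

lemma eqv_C2:
  assumes "co p q r" "co p r s" "p < n" "q < n" "r < n" "s < n" "k < e" "l < e"
  shows "[A p s, A p q, A q r] @ T s k \<approx> [A r q, A r p, A r s] @ T q l"
proof -
  have co: "co r p q" "co r s q" "co p r s" "co r s p" "co p q s" "co q r s"
    using assms(1,2) by (auto simp: co_def)
  have ne: "r \<noteq> s" using assms by (auto simp: co_def)
  have "[A p s, A p q, A q r] @ T s k \<approx> [A p s, A p r, A p q] @ T s k"
    using eqv_in[OF eqv_trans[OF eqv_R3a eqv_R3b], of p q r "[A p s]" "T s k"] assms by simp
  also have "\<dots> \<approx> [A p r, A r s, A p q] @ T s k"
    using eqv_in[OF eqv_sym[OF eqv_trans[OF eqv_R3a eqv_R3b]], of p r s "[]" "[A p q] @ T s k"] assms co by simp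
  also have "\<dots> \<approx> [A p r, A p q, A r s] @ T s k"
    using eqv_in[OF eqv_sym[OF eqv_R1], of p q r s "[A p r]" "T s k"] assms co by simp
  also have "\<dots> \<approx> [A p r, A p q] @ T r k @ [A r s]"
    using eqv_in[OF A_T, of r s k k "[A p r, A p q]" "[]"] assms ne by simp
  also have "\<dots> \<approx> [A r q, A r p] @ T q l @ [A r s]"
    using eqv_in[OF eqv_sym[OF eqv_C3], of r p q l k "[]" "[A r s]"] assms co by simp
  also have "\<dots> \<approx> [A r q, A r p, A r s] @ T q l"
    using eqv_in[OF T_comm, of r s q l "[A r q, A r p]" "[]"] assms co by simp
  finally show ?thesis .
qed

end

section \<open>Cyclic order through integer lifts\<close>

lemma lift_less:
  fixes a b n :: int
  assumes "a < b" "b < a + n"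
  shows "a mod n < b mod n \<and> b div n = a div n \<or> b mod n < a mod n \<and> b div n = a div n + 1"
proof -
  have n: "n > 0" using assms by simp
  have "a div n \<le> b div n" "b div n \<le> (a + n) div n"
    using assms n by (auto intro: zdiv_mono1)
  moreover have "(a + n) div n = a div n + 1" using n div_add_self2[of n a] by simp
  ultimately consider "b div n = a div n" | "b div n = a div n + 1" by linarith
  then show ?thesis
  proof cases
    case 1
    have "n * (a div n) + a mod n = a" "n * (a div n) + b mod n = b"
      using mult_div_mod_eq[of n a] mult_div_mod_eq[of n b] 1 by simp_all
    then show ?thesis using assms 1 by linarith
  next
    case 2
    have "n * (a div n) + a mod n = a" "n * (a div n) + n + b mod n = b"
      using mult_div_mod_eq[of n a] mult_div_mod_eq[of n b] 2 by (simp_all add: distrib_left)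
    then show ?thesis using assms 2 by linarith
  qed
qed

text \<open>Within an interval of length less than n the residues wrap at most once, so they are
  increasing up to a rotation.\<close>

lemma co_lift:
  assumes "a < b" "b < c" "c < a + int n" "int p = a mod int n" "int q = b mod int n" "int r = c mod int n"
  shows "co p q r"
  using lift_less[of a b "int n"] lift_less[of b c "int n"] lift_less[of a c "int n"] assms
  by (simp add: co_def) linarith

lemma cyc_less: "cyc n ps \<Longrightarrow> length ps \<ge> 2 \<Longrightarrow> p \<in> set ps \<Longrightarrow> p < n"
proof -
  assume *: "cyc n ps" "length ps \<ge> 2" "p \<in> set ps"
  then obtain bs where bs: "map (\<lambda>b. b mod int n) bs = map int ps" "sorted_wrt (<) bs"
    "last bs < hd bs + int n" unfolding cyc_def by blast
  have "length bs = length ps" using bs(1) by (metis length_map)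
  then obtain a b l where abl: "bs = a # b # l" using *(2)
    by (metis Suc_le_length_iff numeral_2_eq_2)
  have "b \<le> last bs" using bs(2) abl by (cases l rule: rev_cases) auto
  moreover have "last bs < a + int n" "a < b" using bs(2,3) abl by simp_all
  ultimately have n: "n > 0" by linarith
  have "int p \<in> set (map int ps)" using *(3) by simp
  then obtain b where "int p = b mod int n" using bs(1) by (metis ex_map_conv)
  then show "p < n" using n by (metis of_nat_0_less_iff of_nat_less_iff pos_mod_bound)
qed

lemma cyc3_iff: "cyc n [p, q, r] \<longleftrightarrow> p < n \<and> q < n \<and> r < n \<and> co p q r"
proof
  assume *: "cyc n [p, q, r]"
  then obtain bs where bs: "map (\<lambda>b. b mod int n) bs = map int [p, q, r]" "sorted_wrt (<) bs"
    "last bs < hd bs + int n" unfolding cyc_def by blast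
  then obtain a b c where "bs = [a, b, c]" by (auto simp: map_eq_Cons_conv)
  then have "co p q r" using bs co_lift[of a b c n p q r] by simp
  then show "p < n \<and> q < n \<and> r < n \<and> co p q r" using cyc_less[OF *] by simp
next
  assume *: "p < n \<and> q < n \<and> r < n \<and> co p q r"
  \<comment> \<open>The lifts start at \<open>p\<close>: subscripts below \<open>p\<close> are
    raised by n, the others stay.\<close>
  let ?l = "\<lambda>q. int q + (if q < p then int n else 0)"
  have "map (\<lambda>b. b mod int n) [int p, ?l q, ?l r] = map int [p, q, r]"
    "sorted_wrt (<) [int p, ?l q, ?l r]" "last [int p, ?l q, ?l r] < hd [int p, ?l q, ?l r] + int n"
    using * by (auto simp: co_def)
  then show "cyc n [p, q, r]" unfolding cyc_def by blast
qed

lemma cyc4_iff: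
  "cyc n [p, q, r, s] \<longleftrightarrow> p < n \<and> q < n \<and> r < n \<and> s < n \<and> co p q r \<and> co p r s"
proof
  assume *: "cyc n [p, q, r, s]"
  then obtain bs where bs: "map (\<lambda>b. b mod int n) bs = map int [p, q, r, s]" "sorted_wrt (<) bs"
    "last bs < hd bs + int n" unfolding cyc_def by blast
  then obtain a b c d where "bs = [a, b, c, d]" by (auto simp: map_eq_Cons_conv)
  then have "co p q r" "co p r s"
    using bs co_lift[of a b c n p q r] co_lift[of a c d n p r s] by simp_all
  then show "p < n \<and> q < n \<and> r < n \<and> s < n \<and> co p q r \<and> co p r s"
    using cyc_less[OF *] by simp
next
  assume *: "p < n \<and> q < n \<and> r < n \<and> s < n \<and> co p q r \<and> co p r s"
  let ?l = "\<lambda>q. int q + (if q < p then int n else 0)"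
  have "map (\<lambda>b. b mod int n) [int p, ?l q, ?l r, ?l s] = map int [p, q, r, s]"
    "sorted_wrt (<) [int p, ?l q, ?l r, ?l s]"
    "last [int p, ?l q, ?l r, ?l s] < hd [int p, ?l q, ?l r, ?l s] + int n"
    using * by (auto simp: co_def)
  then show "cyc n [p, q, r, s]" unfolding cyc_def by blast
qed

section \<open>Complements against the relations of R+\<close>

context braid_presentation
begin

notation eqv (infix "\<approx>" 50)

definition res where "res i = nat (i mod int e)"

lemma res_less [simp]: "res i < e"
  using e by (simp add: res_def nat_less_iff)

lemma res_of_nat [simp]: "k < e \<Longrightarrow> res (int k) = k"
  by (simp add: res_def)

lemma res_up: "res (i + 1) = up (res i)"
proof -
  have "int (up (res i)) = (i mod int e + 1) mod int e"
    using e by (simp add: up_def res_def zmod_int add.commute)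
  also have "\<dots> = (i + 1) mod int e" by (simp add: mod_add_left_eq)
  finally show ?thesis by (simp add: res_def)
qed

lemma res_dn: "res (i - 1) = dn (res i)"
  using res_up[of "i - 1"] by simp

lemma ap_res: "ap e p i = E p (res i)"
  by (simp add: ap_def res_def)

lemma t_T: "t e p = T p (res 0)" 
  using res_up[of 0] by (simp add: t_def T_def ap_res)

lemma T_tword: "tword (std j) p = T p j"
  by (simp add: T_def)

lemma is_relE:
  assumes "is_rel F u v" "\<And>W. W \<in> F \<Longrightarrow> \<exists>w. \<forall>x\<in>W. x \<approx> w"
  shows "u \<approx> v"
proof -
  obtain W w where "u \<in> W" "v \<in> W" "\<forall>x\<in>W. x \<approx> w"
    using assms by (auto simp: is_rel_def) metis
  then show ?thesis using eqv_trans eqv_sym by blast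
qed

lemma rels_R_sound:
  assumes "W \<in> rels_R e n" shows "\<exists>w. \<forall>x\<in>W. x \<approx> w"
  using assms
proof cases
  case (R1 p q r s)
  then show ?thesis using eqv_R1[of p q r s] by (auto simp: cyc4_iff)
next
  case (R2 p q r s)
  then show ?thesis using eqv_R2[of p q r s] by (auto simp: cyc4_iff)
next
  case (R3 p q r)
  then have "co p q r" "p < n" "q < n" "r < n" by (simp_all add: cyc3_iff)
  then show ?thesis using R3(1) eqv_R3a[of p q r] eqv_sym[OF eqv_R3b[of p q r]] 
    by (auto intro!: exI[of _ "[A q r, A p r]"])
next
  case (R4 p q r i)
  then show ?thesis using eqv_R4[of p q r "res i"] by (auto simp: cyc3_iff ap_res)
next
  case (R5 p q j i)
  then have "res j = step p q (res i)" by (simp add: step_def res_up)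
  then have "[A p q, ap e q j] \<approx> [ap e p i, A p q]" "[ap e q j, ap e p i] \<approx> [ap e p i, A p q]"
    using R5 eqv_R5b[of p q "res i"] eqv_trans[OF eqv_sym[OF eqv_R5a] eqv_R5b, of p q "res i"]
    by (simp_all add: ap_res)
  then show ?thesis using R5(1) by auto
next
  case (R6 p)
  have "[ap e p i, ap e p (i - 1)] \<approx> T p 0" for i
  proof -
    have "res i = up (res (i - 1))" using res_up[of "i - 1"] by simp
    then show ?thesis using T_eq[of p "res (i - 1)" 0] R6 e by (simp add: ap_res T_def)
  qed
  then show ?thesis using R6 by blast
qed

lemma rels_C_sound:
  assumes "W \<in> rels_C e n" shows "\<exists>w. \<forall>x\<in>W. x \<approx> w"
  using assms
proof cases
  case (C1 p q r s)
  then show ?thesis using eqv_C1[of p q r s] by (auto simp: cyc4_iff)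
next
  case (C2 p q r s)
  then show ?thesis using eqv_C2[of p q r s "res 0" "res 0"] by (auto simp: cyc4_iff t_T)
next
  case (C3 p q r)
  then show ?thesis using eqv_C3[of p q r "res 0" "res 0"] by (auto simp: cyc3_iff t_T)
next
  case (C4 p q r j i k)
  then have co: "co p q r" and n: "p < n" "q < n" "r < n" by (simp_all add: cyc3_iff)
  \<comment> \<open>C4 is indexed by the exponent at q, \<open>eqv_C4\<close> by the one at p; the
    decrement in \<open>j\<close> undoes the increment in \<open>step\<close>.\<close>
  have i: "res i = step p q (res j)"
    using C4(3) res_dn[of i] by (auto simp: step_def)
  moreover have "res k = step q r (res i)"
    using C4(4) by (simp add: step_def res_up)
  then have "res k = step p r (res j)" using step_co[OF co] i by simp
  ultimately show ?thesis using C4(1) eqv_C4[OF co n, of "res j"] by (auto simp: ap_res)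
next
  case (C5 p q)
  then show ?thesis using eqv_C5[of p q "res 0" "res 0"] by (auto simp: t_T)
next
  case (C6 p q i j)
  have T: "[ap e p i, ap e p (i - 1), x] = T p (res (i - 1)) @ [x]" for p i x
    using res_up[of "i - 1"] by (simp add: T_def ap_res)
  have "T p (res (i - 1)) @ [A p q] \<approx> T q (res (j - 1)) @ [A q p]"
    using C6(2,3) by (intro T_swap) auto
  then show ?thesis unfolding C6(1) T by blast
qed

lemma rels_sound: "is_rel (rels_Rplus e n) u v \<Longrightarrow> u \<approx> v"
  using is_relE rels_R_sound rels_C_sound unfolding rels_Rplus_def by blast

lemma is_rel_R: "W \<in> rels_R e n \<Longrightarrow> u \<in> W \<Longrightarrow> v \<in> W \<Longrightarrow> is_rel (rels_Rplus e n) u v"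
  by (auto simp: is_rel_def rels_Rplus_def)

lemma is_rel_C: "W \<in> rels_C e n \<Longrightarrow> u \<in> W \<Longrightarrow> v \<in> W \<Longrightarrow> is_rel (rels_Rplus e n) u v"
  by (auto simp: is_rel_def rels_Rplus_def)

lemma is_rel_sym: "is_rel F u v \<Longrightarrow> is_rel F v u"
  by (auto simp: is_rel_def)

abbreviation rel where "rel \<equiv> is_rel (rels_Rplus e n)"

lemma complement_rel_AA:
  assumes n: "p < n" "q < n" "r < n" "u < n" and ne: "p \<noteq> q" "r \<noteq> u" "p \<noteq> r \<or> q \<noteq> u"
  shows "\<exists>v w. complement (std 0) (A p q) (A r u) = (v, w) \<and> rel (A p q # v) (A r u # w)"
proof -
  have t: "tword (std 0) p = t e p" for p using e by (simp add: t_T T_def res_def)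
  note R = rels_R.R1 rels_R.R2 rels_R.R3 and C = rels_C.C1 rels_C.C2 rels_C.C3 rels_C.C5
  consider "q = r" "p = u" | "q = r" "p \<noteq> u" | "q \<noteq> r" "p = u" | "q \<noteq> r" "p \<noteq> u" "q = u"
    | "q \<noteq> r" "p \<noteq> u" "q \<noteq> u" "p = r" | "q \<noteq> r" "p \<noteq> u" "q \<noteq> u" "p \<noteq> r" by blast
  then show ?thesis
  proof cases
    case 1
    have "rel (A p q # t e q) (A q p # t e p)"
    proof (cases "p < q")
      case True
      then show ?thesis using n by (intro is_rel_C[OF rels_C.C5[of p q]]) auto
    next
      case False
      then show ?thesis using n ne by (intro is_rel_C[OF rels_C.C5[of q p]]) auto
    qed
    then show ?thesis using 1 by (simp add: t del: tword.simps)
  next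
    case 2
    show ?thesis
    proof (cases "co p q u")
      case True
      then have "cyc n [p, q, u]" using n by (simp add: cyc3_iff)
      then have "rel [A p q, A q u] [A q u, A p u]" by (intro is_rel_R[OF rels_R.R3]) auto
      then show ?thesis using 2 True by simp
    next
      case False
      then have "cyc n [q, p, u]" using n ne 2 unfolding cyc3_iff by (metis co_total co_rot)
      then have "rel (A p q # A p u # t e q) (A q u # A q p # t e u)"
        by (intro is_rel_C[OF rels_C.C3]) auto
      then show ?thesis using 2 False by (simp add: t del: tword.simps)
    qed
  next
    case 3
    show ?thesis
    proof (cases "co r u q")
      case True
      then have "cyc n [r, u, q]" using n by (simp add: cyc3_iff)
      then have "rel [A u q, A r q] [A r u, A u q]" by (intro is_rel_R[OF rels_R.R3]) auto
      then show ?thesis using 3 True by simp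
    next
      case False
      then have "cyc n [u, r, q]" using n ne 3 unfolding cyc3_iff by (metis co_total co_rot)
      then have "rel (A u q # A u r # t e q) (A r u # A r q # t e u)"
        by (intro is_rel_C[OF rels_C.C3]) auto
      then show ?thesis using 3 False by (simp add: t del: tword.simps)
    qed
  next
    case 4
    show ?thesis
    proof (cases "co p r q")
      case True
      then have "cyc n [p, r, q]" using n by (simp add: cyc3_iff)
      then have "rel [A p q, A p r] [A r q, A p q]" by (intro is_rel_R[OF rels_R.R3]) auto
      then show ?thesis using 4 True by simp
    next
      case False
      then have "cyc n [r, p, q]" using n ne 4 unfolding cyc3_iff by (metis co_total co_rot)
      then have "rel [A p q, A r q] [A r q, A r p]" by (intro is_rel_R[OF rels_R.R3]) auto
      then show ?thesis using 4 False by simp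
    qed
  next
    case 5
    show ?thesis
    proof (cases "co p q u")
      case True
      then have "cyc n [p, q, u]" using n by (simp add: cyc3_iff)
      then have "rel [A p q, A q u] [A p u, A p q]" by (intro is_rel_R[OF rels_R.R3]) auto
      then show ?thesis using 5 True by simp
    next
      case False
      then have "cyc n [p, u, q]" using n ne 5 unfolding cyc3_iff by (metis co_total co_rot)
      then have "rel [A p q, A p u] [A p u, A u q]" by (intro is_rel_R[OF rels_R.R3]) auto
      then show ?thesis using 5 False by simp
    qed
  next
    case 6
    show ?thesis
    proof (cases "co p r q")
      case prq: True
      consider "co q u p" | "\<not> co q u p" "co p r u" | "\<not> co q u p" "\<not> co p r u" by blast
      then show ?thesis
      proof cases
        case 1
        then have "cyc n [p, r, q, u]" using n prq co_rot by (auto simp: cyc4_iff)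
        then have "rel [A p q, A p r, A q u] [A r u, A p u, A r q]"
          by (intro is_rel_C[OF rels_C.C1]) auto
        then show ?thesis using 6 1 prq by simp
      next
        case 2
        then have "co p u q" using co_total[of p u q] co_rot[of p q u] ne 6 by blast
        then have "cyc n [p, r, u, q]" using n 2 by (simp add: cyc4_iff)
        then have "rel [A p q, A r u] [A r u, A p q]" by (intro is_rel_R[OF rels_R.R2]) auto
        then show ?thesis using 6 2 prq by simp
      next
        case 3
        then have "co p u r" using co_total[of p u r] ne 6 by blast
        then have "cyc n [p, u, r, q]" using n prq by (simp add: cyc4_iff)
        then have "rel (A p q # A p u # A u r # t e q) (A r u # A r p # A r q # t e u)"
          by (intro is_rel_C[OF rels_C.C2]) auto
        then show ?thesis using 6 3 prq by (simp add: t del: tword.simps)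
      qed
    next
      case prq: False
      then have pqr: "co p q r" using co_total ne 6 by metis
      show ?thesis
      proof (cases "co p u q")
        case True
        then have "cyc n [r, p, u, q]"
          using n co_trans[OF True pqr] co_rot[OF pqr] co_rot by (auto simp: cyc4_iff)
        then have "rel [A p q, A r q, A p u] [A r u, A r p, A u q]"
          by (intro is_rel_C[OF rels_C.C1]) auto
        then show ?thesis using 6 True prq by simp
      next
        case False
        then have pqu: "co p q u" using co_total ne 6 by metis
        have "rel [A p q, A r u] [A r u, A p q]"
        proof (cases "co p r u")
          case True
          then have "cyc n [p, q, r, u]" using n pqr by (simp add: cyc4_iff)
          then show ?thesis by (intro is_rel_R[OF rels_R.R1]) auto
        next
          case False
          then have "co p u r" using co_total ne 6 by metis
          then have "cyc n [r, p, q, u]"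
            using n co_rot[OF pqr] co_trans[OF pqu \<open>co p u r\<close>] co_rot by (auto simp: cyc4_iff)
          then show ?thesis by (intro is_rel_R[OF rels_R.R2]) auto
        qed
        then show ?thesis using 6 False prq by simp
      qed
    qed
  qed
qed

lemma complement_rel_AE:
  assumes n: "p < n" "q < n" "r < n" "i < e" and ne: "p \<noteq> q"
  shows "\<exists>v w. complement (std j) (A p q) (E r i) = (v, w) \<and>
    complement (std j) (E r i) (A p q) = (w, v) \<and> rel (A p q # v) (E r i # w)"
proof -
  have i: "ap e p (int i) = E p i" for p using n by (simp add: ap_res)
  have up: "ap e p (int i + 1) = E p (up i)" for p using n by (simp add: ap_res res_up)
  have dn: "ap e p (int i - 1) = E p (dn i)" for p using n by (simp add: ap_res res_dn)
  consider "r = q" | "r \<noteq> q" "r = p" | "r \<noteq> q" "r \<noteq> p" "co p q r" | "r \<noteq> q" "r \<noteq> p" "\<not> co p q r"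
    by blast
  then show ?thesis
  proof cases
    case 1
    have "rel [A p q, E q i] [E q i, E p (if p < q then i else dn i)]"
      by (rule is_rel_R[OF rels_R.R5[of p n q "int i" "if p < q then int i else int i - 1"]])
        (use n ne i dn in auto)
    then show ?thesis using 1 by simp
  next
    case 2
    have "rel [A p q, E q (if p < q then i else up i)] [E p i, A p q]"
      by (rule is_rel_R[OF rels_R.R5[of p n q "if p < q then int i else int i + 1" "int i"]])
        (use n ne i up in auto)
    then show ?thesis using 2 by simp
  next
    case 3
    then have "cyc n [p, q, r]" using n by (simp add: cyc3_iff)
    from is_rel_R[OF rels_R.R4[OF this, where e = e and i = "int i"]]
    have "rel [A p q, E r i] [E r i, A p q]" by (simp add: i)
    then show ?thesis using 3 by simp
  next
    case 4
    then have "cyc n [p, r, q]" using n ne unfolding cyc3_iff by (metis co_total)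
    from is_rel_C[OF rels_C.C4[OF this refl refl, where i = "int i" and e = e]]
    have "rel [A p q, A p r, E q (if r < q then i else up i)]
        [E r i, A r q, E p (if p < r then i else dn i)]"
      by (simp add: i up dn)
    then show ?thesis using 4 by simp
  qed
qed

lemma complement_rel_EE:
  assumes n: "p < n" "q < n" "i < e" "j < e" and ne: "p < q"
  shows "\<exists>v w. complementE (std l) p i q j = (v, w) \<and> rel (E p i # v) (E q j # w)"
proof -
  have ap: "ap e p (int i) = E p i" if "i < e" for p i using that by (simp add: ap_res)
  have dn: "ap e p (int i - 1) = E p (dn i)" if "i < e" for p i using that by (simp add: ap_res res_dn)
  have up: "ap e p (int i + 1) = E p (up i)" if "i < e" for p i using that by (simp add: ap_res res_up)
  consider "i = j" | "i \<noteq> j" "up j = i" | "i \<noteq> j" "up j \<noteq> i" by blast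
  then show ?thesis
  proof cases
    case 1
    have "rel [E p i, A p q] [E q i, E p i]"
      by (rule is_rel_R[OF rels_R.R5[of p n q "int i" "int i"]]) (use n ne ap in auto)
    then show ?thesis using 1 by simp
  next
    case 2
    have "rel [E p i, E q j] [E q j, A q p]"
      by (rule is_rel_R[OF rels_R.R5[of q n p "int j + 1" "int j"]]) (use n ne ap up 2 in auto)
    then show ?thesis using 2 by simp
  next
    case 3
    have "rel [E p i, E p (dn i), A p q] [E q j, E q (dn j), A q p]"
    proof (rule is_rel_C[OF rels_C.C6[of p q n "int i" e "int j"]])
      have "int i mod int e = int i" "int j mod int e = int j" using n by simp_all
      moreover have "(int j + 1) mod int e = int (up j)" by (simp add: up_def zmod_int add.commute)
      ultimately show "int i mod int e \<noteq> int j mod int e" "int i mod int e \<noteq> (int j + 1) mod int e"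
        using 3 by simp_all
    qed (use n ne ap dn in auto)
    then show ?thesis using 3 by simp
  qed
qed

lemma complement_rel:
  assumes "x \<in> G" "y \<in> G" "x \<noteq> y" "complement (std 0) x y = (u, v)"
  shows "rel (x # u) (y # v)"
  using assms(1)
proof (cases rule: G_cases)
  case x: (1 p q)
  from assms(2) show ?thesis
  proof (cases rule: G_cases)
    case (1 r s)
    then show ?thesis using complement_rel_AA[of p q r s] x assms(3,4) by auto
  next
    case (2 r i)
    then show ?thesis using complement_rel_AE[of p q r i 0] x assms(4) by auto
  qed
next
  case x: (2 p i)
  from assms(2) show ?thesis
  proof (cases rule: G_cases)
    case (1 r s)
    then show ?thesis using complement_rel_AE[of r s p i 0] x assms(4) is_rel_sym by auto
  next
    case (2 q j)
    show ?thesis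
    proof (cases p q rule: linorder_cases)
      case less
      then show ?thesis using complement_rel_EE[of p q i j 0] x 2 assms(4) by auto
    next
      case greater
      then show ?thesis using complement_rel_EE[of q p j i 0] x 2 assms(4) is_rel_sym by auto
    next
      case equal
      have *: "[E p i, E p (dn i)] \<in> {[ap e p i, ap e p (i - 1)] |i. True}" if "i < e" for i
        using that by (auto simp: ap_res res_dn intro!: exI[of _ "int i"])
      then have "rel [E p i, E p (dn i)] [E p j, E p (dn j)]"
        using is_rel_R[OF rels_R.R6[of p n e] *[of i] *[of j]] x 2 by simp
      then show ?thesis using x 2 equal assms(4) by auto
    qed
  qed
qed

text \<open>The base exponent enters only through t_p, and all versions of t_p are congruent by
  \<open>T_eq\<close>.\<close>

lemma complement_unique:
  assumes "x \<in> G" "y \<in> G" "x \<noteq> y" "complement (std j) x y = (u, v)" "complement (std k) x y = (u', v')"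
    "j < e" "k < e"
  shows "u \<approx> u' \<and> v \<approx> v'"
proof -
  have T: "T p j \<approx> T p k" if "p < n" for p using T_eq that assms(6,7) by simp
  show ?thesis
    using assms(1)
  proof (cases rule: G_cases)
    case x: (1 p q)
    from assms(2) show ?thesis
    proof (cases rule: G_cases)
      case y: (1 r s)
      note c = assms(4,5)[unfolded x(1) y(1)]
      note [simp] = T_tword T eqv_Cons
      note [simp del] = tword.simps
      consider "q = r" "p = s" | "q = r" "p \<noteq> s" | "q \<noteq> r" "p = s" | "q \<noteq> r" "p \<noteq> s" "q = s"
        | "q \<noteq> r" "p \<noteq> s" "q \<noteq> s" "p = r" | "q \<noteq> r" "p \<noteq> s" "q \<noteq> s" "p \<noteq> r" by blast
      then show ?thesis
      proof cases
        case 1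
        then show ?thesis using c x y by auto
      next
        case 2
        then show ?thesis using c x y by (cases "co p q s") auto
      next
        case 3
        then show ?thesis using c x y by (cases "co r s q") auto
      next
        case 4
        then show ?thesis using c x y by (cases "co p r q") auto
      next
        case 5
        then show ?thesis using c x y by (cases "co p q s") auto
      next
        case 6
        then show ?thesis using c x y
          by (cases "co p r q"; cases "co q s p"; cases "co p r s"; cases "co p s q") auto
      qed
    qed (use x assms(3-5) in \<open>auto split: if_splits\<close>)
  next
    case x: (2 p i)
    from assms(2) show ?thesis
      by (cases rule: G_cases) (use x assms(3-5) in \<open>auto split: if_splits\<close>)
  qed
qed

lemma gcomp_unique: "gcomp x u y v \<Longrightarrow> gcomp x u' y v' \<Longrightarrow> u \<approx> u' \<and> v \<approx> v'"
  unfolding gcomp_def using complement_unique by blast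

lemma gcomp_sound:
  assumes "gcomp x u y v" shows "x # u \<approx> y # v"
proof -
  obtain u0 v0 where *: "complement (std 0) x y = (u0, v0)" by fastforce
  then have "gcomp x u0 y v0" using assms e by (auto simp: gcomp_def intro!: exI[of _ 0])
  then have "u \<approx> u0" "v0 \<approx> v" using gcomp_unique assms by blast+
  moreover have "x # u0 \<approx> y # v0"
    using complement_rel[OF _ _ _ *] rels_sound assms by (simp add: gcomp_def)
  ultimately show ?thesis using eqv_Cons eqv_trans by meson
qed

end

section \<open>Computing the cube condition\<close>

fun valid :: "nat \<Rightarrow> nat \<Rightarrow> gen \<Rightarrow> bool" where
  "valid k L (A p q) \<longleftrightarrow> p < k \<and> q < k \<and> p \<noteq> q"
| "valid k L (E p i) \<longleftrightarrow> p < k \<and> i < L"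

text \<open>Reversing with a bound \<open>f\<close> on the recursion depth. It gives up when a
  complement leaves the model, for instance through the undefined exponent \<open>L\<close>, so a
  result of the form \<open>Some\<close> certifies that every relation used has an image.\<close>

fun rev_words :: "exps \<Rightarrow> nat \<Rightarrow> nat \<Rightarrow> nat \<Rightarrow> gen list \<Rightarrow> gen list \<Rightarrow> (gen list \<times> gen list) option" where
  "rev_words s k L 0 u v = None"
| "rev_words s k L (Suc f) [] v = Some (v, [])"
| "rev_words s k L (Suc f) (x # u) [] = Some ([], x # u)"
| "rev_words s k L (Suc f) (x # u) (y # v) =
    (if x = y then rev_words s k L f u v
     else case complement s x y of (a, b) \<Rightarrow>
       if list_all (valid k L) a \<and> list_all (valid k L) b then
         (case rev_words s k L f u a of None \<Rightarrow> None | Some (c1, d1) \<Rightarrow>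
          case rev_words s k L f b v of None \<Rightarrow> None | Some (c2, d2) \<Rightarrow>
          case rev_words s k L f d1 c2 of None \<Rightarrow> None | Some (c3, d3) \<Rightarrow>
            Some (c1 @ c3, d2 @ d3))
       else None)"

text \<open>The word f with xy f = xz c is found as a reversing with empty second part; the other
  congruence is then checked by reversing to nothing. The depth 40 is a generous bound: too small a
  value could only make a test fail.\<close>

fun cube_test :: "exps \<Rightarrow> nat \<Rightarrow> nat \<Rightarrow> gen \<Rightarrow> gen \<Rightarrow> gen \<Rightarrow> gen list \<Rightarrow> gen list \<Rightarrow> bool" where
  "cube_test s k L x z y g h =
    (case complement s x z of (xz, zx) \<Rightarrow> case complement s x y of (xy, yx) \<Rightarrow>
     list_all (valid k L) (g @ h @ xz @ zx @ xy @ yx) \<and>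
     (case rev_words s k L 40 zx g of None \<Rightarrow> False | Some (c, d) \<Rightarrow>
      (case rev_words s k L 40 xy (xz @ c) of None \<Rightarrow> False | Some (f, f') \<Rightarrow> f' = [] \<and>
        rev_words s k L 40 (h @ d) (yx @ f) = Some ([], []))))"

fun supp :: "gen \<Rightarrow> nat list" where
  "supp (A p q) = [p, q]"
| "supp (E p i) = [p]"

text \<open>A triple that misses a subscript is tested with a smaller \<open>k\<close>, so only
  triples using all \<open>k\<close> subscripts are tried.\<close>

definition cover :: "nat \<Rightarrow> gen \<Rightarrow> gen \<Rightarrow> gen \<Rightarrow> bool" where
  "cover k x y z \<longleftrightarrow> list_all (\<lambda>i. i \<in> set (supp x @ supp y @ supp z)) [0..<k]"

text \<open>\<open>None\<close> stands for the generators $a_{pq}$ and \<open>Some l\<close> for the $a_p^{(i)}$ with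
  \<open>i\<close> in \<open>l\<close>.\<close>

fun letters :: "nat list option \<Rightarrow> nat \<Rightarrow> gen list" where
  "letters None k =
    concat (map (\<lambda>p. concat (map (\<lambda>q. if p = q then [] else [A p q]) [0..<k])) [0..<k])"
| "letters (Some l) k = concat (map (\<lambda>p. map (E p) l) [0..<k])"

definition cube_tests :: "exps \<Rightarrow> nat \<Rightarrow> nat \<Rightarrow> gen list \<Rightarrow> gen list \<Rightarrow> gen list \<Rightarrow> bool" where
  "cube_tests s k L zs ys xs \<longleftrightarrow> list_all (\<lambda>z. list_all (\<lambda>y.
     if y = z then True else if adj s z y then
       (case complement s z y of (g, h) \<Rightarrow> if length g = 1 \<and> length h = 1 then
          list_all (\<lambda>x. if x = z then True else if x = y then True
            else if cover k x y z then cube_test s k L x z y g h else True) xs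
        else True)
     else True) ys) zs"

definition cube_tests_upto ::
    "nat \<Rightarrow> exps \<Rightarrow> nat \<Rightarrow> nat list option \<Rightarrow> nat list option \<Rightarrow> nat list option \<Rightarrow> bool" where
  "cube_tests_upto N s L a b c \<longleftrightarrow>
     list_all (\<lambda>k. cube_tests s k L (letters a k) (letters b k) (letters c k)) [1..<Suc N]"

definition cycle :: "nat \<Rightarrow> exps" where
  "cycle L = (\<lambda>i. if Suc i = L then 0 else Suc i, \<lambda>i. if i = 0 then L - 1 else i - 1, 0)"

text \<open>The value \<open>L\<close> stands for an undefined successor or predecessor. The structure consists
  of the two paths \<open>{..<c}\<close> and \<open>{c..<L}\<close>.\<close>

definition paths :: "nat \<Rightarrow> nat \<Rightarrow> exps" where
  "paths c L =
    (\<lambda>i. if Suc i = c then L else Suc i, \<lambda>i. if i = 0 then L else if i = c then L else i - 1, 0)"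

text \<open>
  Three generators involve at most six subscripts. If all of their exponents agree, then
  reversing only reaches the two adjacent exponents. Otherwise one exponent \<open>b\<close> occurs together
  with \<open>Suc b\<close> or with some exponent in \<open>l\<close>: for large \<open>e\<close>, the exponents reached lie on one
  path if the two are close to each other, and else on two paths without adjacent members.
\<close>

definition tests1 :: "exps \<Rightarrow> nat \<Rightarrow> nat \<Rightarrow> bool" where
  "tests1 s L b \<longleftrightarrow> cube_tests_upto 6 s L None None None \<and>
     cube_tests_upto 5 s L None None (Some [b]) \<and>
     cube_tests_upto 5 s L None (Some [b]) None \<and>
     cube_tests_upto 5 s L (Some [b]) None None"

text \<open>Two exponent generators form a swap only with equal subscripts and adjacent exponents,
  hence the pairs \<open>[b]\<close>, \<open>[Suc b]\<close>. Both orders are tested because the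
  cube condition treats \<open>z\<close> and \<open>y\<close> differently.\<close>

definition tests2 :: "exps \<Rightarrow> nat \<Rightarrow> nat \<Rightarrow> nat list \<Rightarrow> bool" where
  "tests2 s L b l \<longleftrightarrow> cube_tests_upto 4 s L None (Some [b]) (Some l) \<and>
     cube_tests_upto 4 s L (Some [b]) None (Some l) \<and>
     cube_tests_upto 4 s L (Some [b]) (Some [Suc b]) None \<and>
     cube_tests_upto 4 s L (Some [Suc b]) (Some [b]) None \<and>
     cube_tests_upto 3 s L (Some [b]) (Some [Suc b]) (Some l) \<and>
     cube_tests_upto 3 s L (Some [Suc b]) (Some [b]) (Some l)"

fun img :: "(nat \<Rightarrow> nat) \<Rightarrow> (nat \<Rightarrow> nat) \<Rightarrow> gen \<Rightarrow> gen" where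
  "img m \<iota> (A p q) = A (m p) (m q)"
| "img m \<iota> (E p i) = E (m p) (\<iota> i)"

lemma co_mono: "strict_mono m \<Longrightarrow> co (m p) (m q) (m r) \<longleftrightarrow> co p q r"
  by (simp add: co_def strict_mono_less)

section \<open>Transport from finite models\<close>

context braid_presentation
begin

notation eqv (infix "\<approx>" 50)

text \<open>The equivalences both preserve and reflect adjacency, since \<open>complementE\<close>
  also branches on non-adjacency. The base exponent and its successor must lie in the model so that
  t_p has an image.\<close>

definition emb :: "exps \<Rightarrow> nat \<Rightarrow> (nat \<Rightarrow> nat) \<Rightarrow> bool" where
  "emb s L \<iota> \<longleftrightarrow> snd (snd s) < L \<and> fst s (snd (snd s)) < L \<and> (\<forall>i<L. \<iota> i < e) \<and> inj_on \<iota> {..<L} \<and>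
     (\<forall>i<L. \<forall>j<L. (fst s j = i \<longleftrightarrow> \<iota> i = up (\<iota> j)) \<and> (fst (snd s) j = i \<longleftrightarrow> \<iota> i = dn (\<iota> j)))"

text \<open>Every test in \<open>complement\<close> concerns the order of subscripts or the equality
  or adjacency of exponents, and all of these survive the renaming. The validity of \<open>u\<close>
  and \<open>v\<close> excludes undefined neighbours.\<close>

lemma complement_img:
  assumes m: "strict_mono m" and emb: "emb s L \<iota>" and xy: "valid k L x" "valid k L y"
    and c: "complement s x y = (u, v)" and uv: "list_all (valid k L) u" "list_all (valid k L) v"
  shows "complement (std (\<iota> (snd (snd s)))) (img m \<iota> x) (img m \<iota> y) = (map (img m \<iota>) u, map (img m \<iota>) v)"
proof -
  obtain sc pd j where s: "s = (sc, pd, j)" by (cases s) auto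
  note [simp] = co_mono[OF m] strict_mono_eq[OF m] strict_mono_less[OF m]
  have sc: "sc i < L \<Longrightarrow> \<iota> (sc i) = up (\<iota> i)" and pd: "pd i < L \<Longrightarrow> \<iota> (pd i) = dn (\<iota> i)"
    if "i < L" for i using emb that by (auto simp: emb_def s)
  have inj: "\<iota> i = \<iota> i' \<longleftrightarrow> i = i'" and near: "up (\<iota> i') = \<iota> i \<longleftrightarrow> sc i' = i"
    if "i < L" "i' < L" for i i'
    using emb that by (auto simp: emb_def s inj_on_eq_iff)
  have j: "j < L" "sc j < L" using emb by (auto simp: emb_def s)
  have tw: "map (img m \<iota>) (tword s p) = tword (std (\<iota> j)) (m p)" for p
    using j by (simp add: s sc)
  show ?thesis
  proof (cases x; cases y)
    fix p q r t assume "x = A p q" "y = A r t"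
    then have "complement (std (\<iota> j)) (img m \<iota> x) (img m \<iota> y) =
        map_prod (map (img m \<iota>)) (map (img m \<iota>)) (complement s x y)"
      by (simp add: tw if_distrib[of "map_prod _ _"] del: tword.simps)
    then show ?thesis using c by (simp add: s)
  next
    fix p q r i assume "x = A p q" "y = E r i"
    then show ?thesis using c xy uv by (auto simp: s sc pd split: if_splits)
  next
    fix p q r i assume "x = E r i" "y = A p q"
    then show ?thesis using c xy uv by (auto simp: s sc pd split: if_splits)
  next
    fix p i q i' assume *: "x = E p i" "y = E q i'"
    then have i: "i < L" "i' < L" using xy by auto
    have EE: "complementE (std (\<iota> j)) (m p) (\<iota> i) (m q) (\<iota> i') = (map (img m \<iota>) u, map (img m \<iota>) v)"
      if "complementE s p i q i' = (u, v)" "list_all (valid k L) u" "list_all (valid k L) v"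
        "i < L" "i' < L" for p i q i' u v
    proof (cases "i = i'")
      case False
      then show ?thesis using that inj[OF that(4,5)] near[OF that(4,5)]
        by (cases "sc i' = i") (auto simp: s pd)
    qed (use that in \<open>auto simp: s\<close>)
    show ?thesis
    proof (cases p q rule: linorder_cases)
      case less
      then show ?thesis using EE[OF _ uv i, of p q] c * by (simp add: s)
    next
      case equal
      then show ?thesis using c uv * i pd by (auto simp: s)
    next
      case greater
      then have "complementE s q i' p i = (v, u)" using c * by (cases "complementE s q i' p i") simp
      from EE[OF this uv(2,1) i(2,1)] show ?thesis using greater * s by (simp del: complementE.simps)
    qed
  qed
qed

text \<open>For pairs satisfying \<open>adj\<close> the lengths depend on the subscripts alone. So
  whether a pair is a swap can be decided in the model, before anything is known about its
  exponents.\<close>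

lemma complement_img_length:
  assumes m: "strict_mono m" and emb: "emb s L \<iota>" and xy: "valid k L x" "valid k L y"
    and adj: "adj s x y"
    and c: "complement s x y = (u, v)" "complement (std j) (img m \<iota> x) (img m \<iota> y) = (u', v')"
  shows "length u = length u' \<and> length v = length v'"
proof -
  note [simp] = co_mono[OF m] strict_mono_eq[OF m] strict_mono_less[OF m]
  have [simp]: "length (tword s' p) = 2" for s' p by (cases s') auto
  define w w' where "w = complement s x y" and "w' = complement (std j) (img m \<iota> x) (img m \<iota> y)"
  have "length (fst w) = length (fst w') \<and> length (snd w) = length (snd w')"
    unfolding w_def w'_def using adj
    by (cases x; cases y; simp add: if_distrib[of fst] if_distrib[of snd] if_distrib[of length])
  then show ?thesis using c by (simp add: w_def w'_def)
qed

lemma img_inj: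
  assumes "strict_mono m" "emb s L \<iota>" "valid k L x" "valid k L y" "img m \<iota> x = img m \<iota> y"
  shows "x = y"
  using assms by (cases x; cases y) (auto simp: emb_def strict_mono_eq inj_on_eq_iff)

lemma img_G:
  assumes "strict_mono m" "emb s L \<iota>" "\<forall>i<k. m i < n" "valid k L x"
  shows "img m \<iota> x \<in> G"
  using assms by (cases x) (auto simp: emb_def strict_mono_eq)

lemma gcomp_img:
  assumes m: "strict_mono m" "\<forall>i<k. m i < n" and emb: "emb s L \<iota>"
    and xy: "valid k L x" "valid k L y" "x \<noteq> y"
    and c: "complement s x y = (u, v)" "list_all (valid k L) u" "list_all (valid k L) v"
  shows "gcomp (img m \<iota> x) (map (img m \<iota>) u) (img m \<iota> y) (map (img m \<iota>) v)"
proof -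
  have "\<iota> (snd (snd s)) < e" using emb by (auto simp: emb_def)
  then show ?thesis
    unfolding gcomp_def using complement_img[OF m(1) emb xy(1,2) c] img_G[OF m(1) emb m(2)] xy
      img_inj[OF m(1) emb xy(1,2)] by blast
qed

lemma rev_words_img:
  assumes m: "strict_mono m" "\<forall>i<k. m i < n" and emb: "emb s L \<iota>"
    and "rev_words s k L f u v = Some (c, d)" "list_all (valid k L) u" "list_all (valid k L) v"
  shows "reverses gcomp (map (img m \<iota>) u) (map (img m \<iota>) v) (map (img m \<iota>) c) (map (img m \<iota>) d) \<and>
    list_all (valid k L) c \<and> list_all (valid k L) d"
  using assms(4-6)
proof (induction f arbitrary: u v c d)
  case (Suc f)
  consider "u = []" | x u' where "u = x # u'" "v = []"
    | x u' v' where "u = x # u'" "v = x # v'" | x u' y v' where "u = x # u'" "v = y # v'" "x \<noteq> y"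
    by (metis list.exhaust)
  then show ?case
  proof cases
    case (4 x u' y v')
    obtain a b where ab: "complement s x y = (a, b)" by fastforce
    from 4 ab Suc.prems(1) have v: "list_all (valid k L) a" "list_all (valid k L) b"
      by (auto split: if_splits)
    from 4 ab Suc.prems(1) v obtain c1 d1 c2 d2 c3 d3 where
      r: "rev_words s k L f u' a = Some (c1, d1)" "rev_words s k L f b v' = Some (c2, d2)"
        "rev_words s k L f d1 c2 = Some (c3, d3)" "c = c1 @ c3" "d = d2 @ d3"
      by (auto split: option.splits)
    note h1 = Suc.IH[OF r(1)] and h2 = Suc.IH[OF r(2)] and h3 = Suc.IH[OF r(3)]
    have "gcomp (img m \<iota> x) (map (img m \<iota>) a) (img m \<iota> y) (map (img m \<iota>) b)"
      using gcomp_img[OF m emb _ _ 4(3) ab v] Suc.prems(2,3) 4 by simp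
    note * = reverses_diff[of gcomp, OF this]
    have "reverses gcomp (map (img m \<iota>) u') (map (img m \<iota>) a) (map (img m \<iota>) c1) (map (img m \<iota>) d1)"
      "reverses gcomp (map (img m \<iota>) b) (map (img m \<iota>) v') (map (img m \<iota>) c2) (map (img m \<iota>) d2)"
      "reverses gcomp (map (img m \<iota>) d1) (map (img m \<iota>) c2) (map (img m \<iota>) c3) (map (img m \<iota>) d3)"
      and "list_all (valid k L) c" "list_all (valid k L) d"
      using h1 h2 h3 v Suc.prems(2,3) 4 r(4,5) by auto
    then show ?thesis using * 4 r(4,5) by simp
  qed (use Suc in \<open>auto intro: reverses.intros\<close>)
qed simp

text \<open>A swap acts on two letters, so a one-letter word admits none.\<close>

lemma eqv_single: "[x] \<approx> u \<Longrightarrow> u = [x]"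
  unfolding swap_eq_def
  by (induction rule: rtranclp_induct) (auto elim!: swap_step.cases simp: Cons_eq_append_conv)

definition cube_at where
  "cube_at x z g y h \<longleftrightarrow> (\<exists>xz zx c d u v f. gcomp x xz z zx \<and> reverses gcomp zx [g] c d \<and>
     gcomp x u y v \<and> xz @ c \<approx> u @ f \<and> h # d \<approx> v @ f)"

lemma cube_test_img:
  assumes m: "strict_mono m" "\<forall>i<k. m i < n" and emb: "emb s L \<iota>"
    and xyz: "valid k L x" "valid k L y" "valid k L z" "x \<noteq> z" "x \<noteq> y"
    and t: "cube_test s k L x z y [g] [h]"
  shows "cube_at (img m \<iota> x) (img m \<iota> z) (img m \<iota> g) (img m \<iota> y) (img m \<iota> h)"
proof -
  let ?i = "map (img m \<iota>)"
  obtain xz zx xy yx where c: "complement s x z = (xz, zx)" "complement s x y = (xy, yx)" by fastforce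
  have v: "list_all (valid k L) [g]" "list_all (valid k L) [h]" "list_all (valid k L) xz"
      "list_all (valid k L) zx" "list_all (valid k L) xy" "list_all (valid k L) yx"
    using t c by auto
  obtain c' d f where r: "rev_words s k L 40 zx [g] = Some (c', d)"
      "rev_words s k L 40 xy (xz @ c') = Some (f, [])"
      "rev_words s k L 40 (h # d) (yx @ f) = Some ([], [])"
    using t c by (auto split: option.splits)
  note img = rev_words_img[OF m emb]
  have 1: "reverses gcomp (?i zx) [img m \<iota> g] (?i c') (?i d)" and v1: "list_all (valid k L) c'" "list_all (valid k L) d"
    using img[OF r(1)] v by auto
  have 2: "reverses gcomp (?i xy) (?i (xz @ c')) (?i f) []" and v2: "list_all (valid k L) f"
    using img[OF r(2)] v v1 by auto
  have 3: "reverses gcomp (?i (h # d)) (?i (yx @ f)) [] []"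
    using img[OF r(3)] v v1 v2 by auto
  have "gcomp (img m \<iota> x) (?i xz) (img m \<iota> z) (?i zx)"
    using gcomp_img[OF m emb xyz(1,3,4) c(1) v(3,4)] .
  moreover have "gcomp (img m \<iota> x) (?i xy) (img m \<iota> y) (?i yx)"
    using gcomp_img[OF m emb xyz(1,2,5) c(2) v(5,6)] .
  moreover have "?i xz @ ?i c' \<approx> ?i xy @ ?i f"
    using eqv_sym[OF reverses_eqv[OF 2 gcomp_sound]] by simp
  moreover have "img m \<iota> h # ?i d \<approx> ?i yx @ ?i f"
    using reverses_eqv[OF 3 gcomp_sound] by simp
  ultimately show ?thesis unfolding cube_at_def using 1 by blast
qed

lemma adj_img:
  assumes "strict_mono m" "emb s L \<iota>" "valid k L z" "valid k L y"
    "adj (std 0) (img m \<iota> z) (img m \<iota> y)"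
  shows "adj s z y"
  using assms by (cases z; cases y) (auto simp: strict_mono_eq emb_def)

lemma enumerate_subscripts:
  assumes "finite P" "P \<subseteq> {..<n}"
  obtains m :: "nat \<Rightarrow> nat" where "strict_mono m" "m ` {..<card P} = P"
proof
  let ?xs = "sorted_list_of_set P"
  \<comment> \<open>Beyond the subscripts in \<open>P\<close> the values n + i only serve to make
    the map increasing on all naturals.\<close>
  let ?m = "\<lambda>i. if i < card P then ?xs ! i else n + i"
  have len: "length ?xs = card P" using assms by simp
  have nth: "?xs ! i \<in> P" if "i < card P" for i
    using that nth_mem[of i ?xs] assms by simp
  show "strict_mono ?m"
  proof (rule strict_monoI)
    fix i j :: nat assume "i < j"
    moreover have "?xs ! i < ?xs ! j" if "j < card P"
      using sorted_wrt_nth_less[OF strict_sorted_list_of_set \<open>i < j\<close>] that len by simp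
    moreover have "?xs ! i < n + j" if "i < card P" using nth[OF that] assms(2) by fastforce
    ultimately show "?m i < ?m j" by auto
  qed
  have "?m ` {..<card P} = (!) ?xs ` {..<card P}" by simp
  also have "\<dots> = set ?xs" unfolding set_conv_nth using len by auto
  finally show "?m ` {..<card P} = P" using assms by simp
qed

definition fits where
  "fits L \<iota> a x \<longleftrightarrow>
     (case a of None \<Rightarrow> \<exists>p q. x = A p q | Some l \<Rightarrow> \<exists>p i. i \<in> set l \<and> i < L \<and> x = E p (\<iota> i))"

definition weight where "weight a = (case a of None \<Rightarrow> 2 | Some l \<Rightarrow> (1::nat))"

lemma fits_supp: "fits L \<iota> a x \<Longrightarrow> length (supp x) = weight a"
  by (auto simp: fits_def weight_def split: option.splits)

lemma fits_preimage:
  assumes "fits L \<iota> a x" "x \<in> G" "strict_mono m" "set (supp x) \<subseteq> m ` {..<k}"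
  obtains x' where "x' \<in> set (letters a k)" "valid k L x'" "x = img m \<iota> x'" "m ` set (supp x') = set (supp x)"
proof (cases a)
  case None
  then obtain p q where x: "x = A p q" using assms(1) by (auto simp: fits_def)
  then obtain p' q' where "p' < k" "q' < k" "p = m p'" "q = m q'" using assms(4) by auto
  moreover from this have "p' \<noteq> q'" using x assms(2) by auto
  ultimately show thesis using None x by (intro that[of "A p' q'"]) auto
next
  case (Some l)
  then obtain p i where x: "i \<in> set l" "i < L" "x = E p (\<iota> i)" using assms(1) by (auto simp: fits_def)
  then obtain p' where "p' < k" "p = m p'" using assms(4) by auto
  then show thesis using Some x by (intro that[of "E p' i"]) auto
qed

lemma supp_G: "x \<in> G \<Longrightarrow> set (supp x) \<subseteq> {..<n}"
  by (cases x) auto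

lemma supp_nonempty: "supp x \<noteq> []"
  by (cases x) auto

text \<open>The subscripts that occur are renumbered increasingly as 0, ..., k - 1. This turns the
  triple into one of the tested triples, whose cube condition is then mapped back.\<close>

lemma cube_via:
  assumes emb: "emb s L \<iota>" and t: "cube_tests_upto N s L a b c"
    and w: "weight a + weight b + weight c \<le> N"
    and f: "fits L \<iota> a z" "fits L \<iota> b y" "fits L \<iota> c x"
    and g: "gstep z g y h" and x: "x \<in> G" "x \<noteq> z" "x \<noteq> y"
  shows "cube_at x z g y h"
proof -
  have zy: "z \<in> G" "y \<in> G" "z \<noteq> y" "adj (std 0) z y" "complement (std 0) z y = ([g], [h])"
    using g by (auto simp: gstep_def)
  define P where "P = set (supp z @ supp y @ supp x)"
  have "finite P" "P \<subseteq> {..<n}" using supp_G zy(1,2) x(1) by (auto simp: P_def)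
  then obtain m where m: "strict_mono m" "m ` {..<card P} = P" by (rule enumerate_subscripts)
  define k where "k = card P"
  have "k \<le> length (supp z @ supp y @ supp x)" unfolding k_def P_def by (rule card_length)
  then have "k \<le> N" using fits_supp[OF f(1)] fits_supp[OF f(2)] fits_supp[OF f(3)] w by simp
  moreover have "k > 0" using supp_nonempty[of z] by (auto simp: k_def P_def card_gt_0_iff)
  ultimately have k: "k \<in> set [1..<Suc N]" by auto
  have sub: "set (supp z) \<subseteq> m ` {..<k}" "set (supp y) \<subseteq> m ` {..<k}" "set (supp x) \<subseteq> m ` {..<k}"
    unfolding k_def m(2) by (auto simp: P_def)
  obtain z' where z': "z' \<in> set (letters a k)" "valid k L z'" "z = img m \<iota> z'" "m ` set (supp z') = set (supp z)"
    using fits_preimage[OF f(1) zy(1) m(1) sub(1)] .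
  obtain y' where y': "y' \<in> set (letters b k)" "valid k L y'" "y = img m \<iota> y'" "m ` set (supp y') = set (supp y)"
    using fits_preimage[OF f(2) zy(2) m(1) sub(2)] .
  obtain x' where x': "x' \<in> set (letters c k)" "valid k L x'" "x = img m \<iota> x'" "m ` set (supp x') = set (supp x)"
    using fits_preimage[OF f(3) x(1) m(1) sub(3)] .
  have mn: "\<forall>i<k. m i < n"
    using m(2) \<open>P \<subseteq> {..<n}\<close> k_def by blast
  have "m ` {..<k} = m ` set (supp x' @ supp y' @ supp z')"
    unfolding k_def m(2) by (simp add: image_Un x'(4) y'(4) z'(4)) (auto simp: P_def)
  then have "{..<k} = set (supp x' @ supp y' @ supp z')"
    using strict_mono_imp_inj_on[OF m(1), of UNIV] by (simp only: inj_image_eq_iff)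
  note supp = this[symmetric]
  have cov: "cover k x' y' z'" unfolding cover_def list_all_iff supp by simp
  obtain u v where uv: "complement s z' y' = (u, v)" by fastforce
  have ne: "z' \<noteq> y'" "x' \<noteq> z'" "x' \<noteq> y'" using zy(3) x(2,3) z'(3) y'(3) x'(3) by auto
  have adj: "adj s z' y'" using adj_img[OF m(1) emb z'(2) y'(2)] zy(4) z'(3) y'(3) by simp
  have single: "length u = 1 \<and> length v = 1"
    using complement_img_length[OF m(1) emb z'(2) y'(2) adj uv, of 0 "[g]" "[h]"] zy(5) z'(3) y'(3) by simp
  have "cube_test s k L x' z' y' u v"
    using t k z'(1) y'(1) x'(1) ne adj uv single cov
    unfolding cube_tests_upto_def cube_tests_def list_all_iff by fastforce
  moreover obtain g' h' where gh: "u = [g']" "v = [h']"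
    using single by (metis One_nat_def length_0_conv length_Suc_conv)
  ultimately have "cube_at x z (img m \<iota> g') y (img m \<iota> h')" and val: "valid k L g'" "valid k L h'"
    using cube_test_img[OF m(1) mn emb x'(2) y'(2) z'(2) ne(2,3)] x'(3) y'(3) z'(3)
    by (auto split: prod.splits)
  moreover have "gcomp z [img m \<iota> g'] y [img m \<iota> h']"
    using gcomp_img[OF m(1) mn emb z'(2) y'(2) ne(1) uv] val gh z'(3) y'(3) by simp
  moreover have "gcomp z [g] y [h]" using zy e by (auto simp: gcomp_def intro!: exI[of _ 0])
  \<comment> \<open>The model may write t_p from another exponent, so uniqueness only gives
    congruence with \<open>g\<close> and \<open>h\<close>; for single letters this is
    equality.\<close>
  ultimately show ?thesis using gcomp_unique eqv_single by (metis list.inject)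
qed

lemma mod_shift_eq_iff:
  assumes "x < e" "y < e"
  shows "(a + x) mod e = (a + y) mod e \<longleftrightarrow> x = y"
proof -
  have "x = y" if "x \<le> y" "x < e" "y < e" "(a + x) mod e = (a + y) mod e" for x y
  proof -
    have "e dvd y - x" using that mod_eq_dvd_iff_nat[of "a + x" "a + y" e] by simp
    then show ?thesis using that by (auto dest: dvd_imp_le)
  qed
  then show ?thesis using assms by (metis nat_le_linear)
qed

lemma up_shift: "up ((a + x) mod e) = (a + up x) mod e"
  unfolding up_def by (metis add_Suc_right mod_Suc_eq mod_add_right_eq)

text \<open>Rotation by \<open>a\<close> commutes with \<open>up\<close>, so adjacency need only be
  checked for the unrotated offsets.\<close>

lemma emb_shift:
  assumes j: "snd (snd s) < L" "fst s (snd (snd s)) < L"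
    and off: "\<And>i. i < L \<Longrightarrow> off i < e" "inj_on off {..<L}"
    and s: "\<And>i j. i < L \<Longrightarrow> j < L \<Longrightarrow> fst s j = i \<longleftrightarrow> off i = up (off j)"
      "\<And>i j. i < L \<Longrightarrow> j < L \<Longrightarrow> fst (snd s) j = i \<longleftrightarrow> off j = up (off i)"
  shows "emb s L (\<lambda>i. (a + off i) mod e)"
proof -
  have "(a + off i) mod e = up ((a + off j) mod e) \<longleftrightarrow> off i = up (off j)" if "i < L" "j < L" for i j
    unfolding up_shift using that off(1) by (intro mod_shift_eq_iff) auto
  moreover have "(a + off i) mod e = dn ((a + off j) mod e) \<longleftrightarrow> off j = up (off i)"
    if "i < L" "j < L" for i j
  proof -
    have "(a + off i) mod e = dn ((a + off j) mod e) \<longleftrightarrow> (a + off j) mod e = up ((a + off i) mod e)"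
      using e by (intro iffI) simp_all
    also have "\<dots> \<longleftrightarrow> off j = up (off i)"
      unfolding up_shift using that off(1) by (intro mod_shift_eq_iff) auto
    finally show ?thesis .
  qed
  moreover have "inj_on (\<lambda>i. (a + off i) mod e) {..<L}"
    using off mod_shift_eq_iff by (auto simp: inj_on_def)
  ultimately show ?thesis using j s e by (auto simp: emb_def)
qed

lemma emb_cycle:
  assumes "e \<ge> 2"
  shows "emb (cycle e) e (\<lambda>i. (a + i) mod e)"
proof (rule emb_shift[where off = "\<lambda>i. i"])
  have up: "up i = (if Suc i = e then 0 else Suc i)" if "i < e" for i
    using that by (simp add: up_def)
  show "fst (cycle e) j = i \<longleftrightarrow> i = up j" if "i < e" "j < e" for i j
    using that by (auto simp: cycle_def up)
  show "fst (snd (cycle e)) j = i \<longleftrightarrow> j = up i" if "i < e" "j < e" for i j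
    using that by (auto simp: cycle_def up)
qed (use assms in \<open>auto simp: cycle_def\<close>)

text \<open>The second path starts at offset \<open>d\<close>. The bounds leave a gap after each
  path, so the ends are not adjacent on the cycle; \<open>1 < c\<close> keeps the exponents 0 and 1
  of t_p inside the first path.\<close>

lemma emb_paths:
  assumes c: "1 < c" "c \<le> L" and d: "c = L \<and> L < e \<or> c < d \<and> d + (L - c) < e"
  shows "emb (paths c L) L (\<lambda>i. (a + (if i < c then i else d + (i - c))) mod e)"
proof (rule emb_shift)
  let ?off = "\<lambda>i. if i < c then i else d + (i - c)"
  have up: "up (?off i) = Suc (?off i)" and less: "?off i < e" if "i < L" for i
    using that d by (auto simp: up_def)
  show "?off i < e" if "i < L" for i using less that .
  show "inj_on ?off {..<L}" using d by (auto simp: inj_on_def split: if_splits)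
  show "fst (paths c L) j = i \<longleftrightarrow> ?off i = up (?off j)" if "i < L" "j < L" for i j
    unfolding up[OF that(2)] using that c d by (auto simp: paths_def)
  show "fst (snd (paths c L)) j = i \<longleftrightarrow> ?off j = up (?off i)" if "i < L" "j < L" for i j
    unfolding up[OF that(1)] using that c d by (auto simp: paths_def)
qed (use c in \<open>auto simp: paths_def\<close>)

lemma shift_to: "i < e \<Longrightarrow> b < e \<Longrightarrow> \<exists>a. (a + b) mod e = i"
  by (rule exI[of _ "i + (e - b)"]) simp

lemma shift_by:
  assumes "i < e" "j < e"
  obtains d where "d < e" "j = (i + d) mod e"
proof
  show "(j + (e - i)) mod e < e" using e by simp
  have "(i + (j + (e - i)) mod e) mod e = (i + (j + (e - i))) mod e" by (simp add: mod_add_right_eq)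
  also have "\<dots> = j" using assms by simp
  finally show "j = (i + (j + (e - i)) mod e) mod e" by simp
qed

end

section \<open>The finite computations\<close>

lemma tests1_cycle2: "tests1 (cycle 2) 2 0" by code_simp
lemma tests1_cycle3: "tests1 (cycle 3) 3 0" by code_simp
lemma tests1_path: "tests1 (paths 3 3) 3 1" by code_simp
lemma tests2_cycle: "\<forall>L\<in>{2, 3, 4, 5, 6, 7}. tests2 (cycle L) L 0 [0..<L]"
proof -
  have "tests2 (cycle 2) 2 0 [0..<2]" "tests2 (cycle 3) 3 0 [0..<3]" by code_simp+
  moreover have "tests2 (cycle 4) 4 0 [0..<4]" "tests2 (cycle 5) 5 0 [0..<5]" by code_simp+
  moreover have "tests2 (cycle 6) 6 0 [0..<6]" by code_simp
  moreover have "tests2 (cycle 7) 7 0 [0..<7]" by code_simp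
  ultimately show ?thesis by simp
qed
text \<open>In this test and the next two, the exponents \<open>b\<close>, \<open>Suc b\<close> and
  those in the list avoid the ends of their paths, which leaves one neighbour on each side for the
  reversing.\<close>

lemma tests2_paths_low: "tests2 (paths 7 7) 7 1 [1..<6]" by code_simp
lemma tests2_paths_high: "tests2 (paths 7 7) 7 4 [1..<4]" by code_simp
lemma tests2_paths_far: "tests2 (paths 4 7) 7 1 [5]" by code_simp

context braid_presentation
begin

lemma structure1:
  assumes "e \<ge> 2" "i < e"
  obtains s L \<iota> b where "emb s L \<iota>" "tests1 s L b" "b < L" "\<iota> b = i"
proof -
  consider "e = 2" | "e = 3" | "e \<ge> 4" using assms(1) by linarith
  then show thesis
  proof cases
    case 1
    then show thesis
      using that[OF emb_cycle[OF assms(1), of i], of 0] tests1_cycle2 assms by simp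
  next
    case 2
    then show thesis
      using that[OF emb_cycle[OF assms(1), of i], of 0] tests1_cycle3 assms by simp
  next
    case 3
    obtain a where a: "(a + 1) mod e = i" using shift_to[of i 1] assms by auto
    have "emb (paths 3 3) 3 (\<lambda>i. (a + (if i < 3 then i else 0 + (i - 3))) mod e)"
      using 3 by (intro emb_paths) auto
    from that[OF this tests1_path] show thesis using a by simp
  qed
qed

text \<open>\<open>d\<close> is the distance from \<open>i\<close> to \<open>j\<close> along the
  cycle. For e >= 8, distances up to 4 fit after \<open>b = 1\<close> in a path of seven, distances
  from e - 3 on fit before \<open>b = 4\<close>, and the rest are far enough for separate paths of
  four and three.\<close>

lemma structure2:
  assumes "e \<ge> 2" "i < e" "j < e"
  obtains s L \<iota> b l k where "emb s L \<iota>" "tests2 s L b l" "Suc b < L" "\<iota> b = i" "\<iota> (Suc b) = up i"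
    "k \<in> set l" "k < L" "\<iota> k = j"
proof -
  obtain d where d: "d < e" "j = (i + d) mod e" using shift_by assms(2,3) by blast
  show thesis
  proof (cases "e \<le> 7")
    case True
    then have "e \<in> {2, 3, 4, 5, 6, 7}" using assms(1) by auto
    then have "tests2 (cycle e) e 0 [0..<e]" using tests2_cycle by blast
    then show thesis
      using that[OF emb_cycle[OF assms(1), of i], of 0 "[0..<e]" d] assms d by (simp add: up_def)
  next
    case False
    then have e8: "e \<ge> 8" by simp
    have emb7: "emb (paths 7 7) 7 (\<lambda>i. (a + (if i < 7 then i else 0 + (i - 7))) mod e)" for a
      using e8 by (intro emb_paths) auto
    consider "d \<le> 4" | "d + 3 \<ge> e" | "5 \<le> d" "d + 4 \<le> e" by linarith
    then show thesis
    proof cases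
      case 1
      obtain a where a: "(a + 1) mod e = i" using shift_to[of i 1] assms by auto
      have "(a + Suc d) mod e = j" using a d(2) by (metis add.assoc add.commute mod_add_left_eq plus_1_eq_Suc)
      moreover have "(a + 2) mod e = up i" using a up_shift[of a 1] e8 by (simp add: up_def)
      ultimately show thesis using 1 a
        by (intro that[OF emb7 tests2_paths_low, of a "Suc d"]) (auto simp: numeral_2_eq_2)
    next
      case 2
      obtain a where a: "(a + 4) mod e = i" using shift_to[of i 4] assms e8 by auto
      obtain c where c: "d + 4 = c + e" "c \<in> set [1..<4]"
        using 2 d(1) by (intro that[of "d + 4 - e"]) auto
      have "(i + d) mod e = (a + (d + 4)) mod e" using a by (metis add.assoc add.commute mod_add_left_eq)
      also have "\<dots> = (a + c) mod e" unfolding c(1) by (simp flip: add.assoc)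
      finally have "(a + c) mod e = j" using d(2) by simp
      moreover have "(a + 5) mod e = up i" using a up_shift[of a 4] e8 by (simp add: up_def)
      ultimately show thesis using c a
        by (intro that[OF emb7 tests2_paths_high, of a c]) auto
    next
      case 3
      obtain a where a: "(a + 1) mod e = i" using shift_to[of i 1] assms by auto
      have "(a + (d + 1)) mod e = j" using a d(2) by (metis add.assoc add.commute mod_add_left_eq)
      moreover have "(a + 2) mod e = up i" using a up_shift[of a 1] e8 by (simp add: up_def)
      moreover have emb: "emb (paths 4 7) 7 (\<lambda>i. (a + (if i < 4 then i else d + (i - 4))) mod e)"
        using 3 by (intro emb_paths) auto
      ultimately show thesis using a
        by (intro that[OF emb tests2_paths_far, of 5]) (auto simp: numeral_2_eq_2)
    qed
  qed
qed

lemma cube_condition: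
  assumes e2: "e \<ge> 2" and g: "gstep z g y h" and x: "x \<in> G" "x \<noteq> z" "x \<noteq> y"
  shows "cube_at x z g y h"
proof -
  have zy: "z \<in> G" "y \<in> G" "adj (std 0) z y" using g by (auto simp: gstep_def)
  note via = cube_via[OF _ _ _ _ _ _ g x]
  have one: "cube_at x z g y h" if "z = A p q" "y = A r t" "x = A r' t'" for p q r t r' t'
  proof -
    \<comment> \<open>No exponent occurs in the triple, so a structure around any exponent will
      do.\<close>
    obtain s L \<iota> b where "emb s L \<iota>" "tests1 s L b" using structure1[OF e2, of 0] e by (metis less_eq_Suc_le One_nat_def)
    then show ?thesis using that
      by (intro via[of s L \<iota> 6 None None None]) (auto simp: tests1_def fits_def weight_def)
  qed
  have two: "cube_at x z g y h" if "z = E p i" "y = E p i'" for p i i'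
  proof -
    \<comment> \<open>The one of the two adjacent exponents whose successor is the other; it is
      placed at \<open>b\<close> in the model.\<close>
    define i0 where "i0 = (if up i = i' then i else i')"
    define j where "j = (case x of A _ _ \<Rightarrow> 0 | E _ j \<Rightarrow> j)"
    have i: "i < e" "i' < e" using zy that by auto
    then have "i0 < e" "i = i0 \<and> i' = up i0 \<or> i' = i0 \<and> i = up i0"
      using zy(3) that by (auto simp: i0_def)
    moreover have "j < e" using x(1) e2 by (cases x) (auto simp: j_def)
    ultimately obtain s L \<iota> b l k where *: "emb s L \<iota>" "tests2 s L b l" "Suc b < L" "\<iota> b = i0"
      "\<iota> (Suc b) = up i0" "k \<in> set l" "k < L" "\<iota> k = j" using structure2[OF e2] by metis
    from \<open>i = i0 \<and> i' = up i0 \<or> i' = i0 \<and> i = up i0\<close> show ?thesis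
    proof
      assume i: "i = i0 \<and> i' = up i0"
      show ?thesis
      proof (cases x)
        case (A p q)
        then show ?thesis using * i that
          by (intro via[of s L \<iota> 4 "Some [b]" "Some [Suc b]" None])
            (auto simp: tests2_def fits_def weight_def)
      next
        case (E q j')
        then show ?thesis using * i that
          by (intro via[of s L \<iota> 3 "Some [b]" "Some [Suc b]" "Some l"])
            (auto simp: tests2_def fits_def weight_def j_def)
      qed
    next
      assume i: "i' = i0 \<and> i = up i0"
      show ?thesis
      proof (cases x)
        case (A p q)
        then show ?thesis using * i that
          by (intro via[of s L \<iota> 4 "Some [Suc b]" "Some [b]" None])
            (auto simp: tests2_def fits_def weight_def)
      next
        case (E q j')
        then show ?thesis using * i that
          by (intro via[of s L \<iota> 3 "Some [Suc b]" "Some [b]" "Some l"])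
            (auto simp: tests2_def fits_def weight_def j_def)
      qed
    qed
  qed
  show ?thesis
    using zy(1)
  proof (cases rule: G_cases)
    case z: (1 p q)
    from zy(2) show ?thesis
    proof (cases rule: G_cases)
      case y: (1 r t)
      from x(1) show ?thesis
      proof (cases rule: G_cases)
        case (2 p i)
        obtain s L \<iota> b where "emb s L \<iota>" "tests1 s L b" "b < L" "\<iota> b = i"
          using structure1[OF e2 2(3)] .
        then show ?thesis using z y 2
          by (intro via[of s L \<iota> 5 None None "Some [b]"]) (auto simp: tests1_def fits_def weight_def)
      qed (use one z y in blast)
    next
      case y: (2 r i)
      from x(1) show ?thesis
      proof (cases rule: G_cases)
        case 1
        obtain s L \<iota> b where "emb s L \<iota>" "tests1 s L b" "b < L" "\<iota> b = i"
          using structure1[OF e2 y(3)] .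
        then show ?thesis using z y 1
          by (intro via[of s L \<iota> 5 None "Some [b]" None]) (auto simp: tests1_def fits_def weight_def)
      next
        case (2 p j)
        obtain s L \<iota> b l k where "emb s L \<iota>" "tests2 s L b l" "Suc b < L" "\<iota> b = i"
          "k \<in> set l" "k < L" "\<iota> k = j" using structure2[OF e2 y(3) 2(3)] by metis
        then show ?thesis using z y 2
          by (intro via[of s L \<iota> 4 None "Some [b]" "Some l"]) (auto simp: tests2_def fits_def weight_def)
      qed
    qed
  next
    case z: (2 p i)
    from zy(2) show ?thesis
    proof (cases rule: G_cases)
      case y: (1 r t)
      from x(1) show ?thesis
      proof (cases rule: G_cases)
        case 1
        obtain s L \<iota> b where "emb s L \<iota>" "tests1 s L b" "b < L" "\<iota> b = i"
          using structure1[OF e2 z(3)] .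
        then show ?thesis using z y 1
          by (intro via[of s L \<iota> 5 "Some [b]" None None]) (auto simp: tests1_def fits_def weight_def)
      next
        case (2 p j)
        obtain s L \<iota> b l k where "emb s L \<iota>" "tests2 s L b l" "Suc b < L" "\<iota> b = i"
          "k \<in> set l" "k < L" "\<iota> k = j" using structure2[OF e2 z(3) 2(3)] by metis
        then show ?thesis using z y 2
          by (intro via[of s L \<iota> 4 "Some [b]" None "Some l"]) (auto simp: tests2_def fits_def weight_def)
      qed
    next
      case y: (2 r j)
      then have "r = p" using zy(3) z by simp
      then show ?thesis using two z y by blast
    qed
  qed
qed

end

text \<open>For \<open>e = 1\<close> and \<open>n \<le> 1\<close> there is at most one generator.\<close>

locale proper_braid_presentation = braid_presentation +
  assumes n: "e = 1 \<longrightarrow> n \<le> 1"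

sublocale proper_braid_presentation \<subseteq> cube_presentation G gstep "rels_Rplus e n" gcomp
proof
  fix x z y :: gen and g h u v u' v'
  show "rel [z, g] [y, h]" if "gstep z g y h"
    using that complement_rel by (auto simp: gstep_def)
  show "gcomp z [g] y [h]" if "gstep z g y h"
    using that e by (auto simp: gstep_def gcomp_def intro!: exI[of _ 0])
  show "x \<in> G \<and> y \<in> G \<and> x \<noteq> y \<and> u \<in> lists G \<and> v \<in> lists G" if "gcomp x u y v"
    using that complement_lists unfolding gcomp_def by blast
  show "swap_eq gstep (x # u) (y # v)" if "gcomp x u y v"
    using that by (rule gcomp_sound)
  show "swap_eq gstep u u' \<and> swap_eq gstep v v'" if "gcomp x u y v" "gcomp x u' y v'"
    using that by (rule gcomp_unique)
  show "\<exists>u v. gcomp x u y v \<and> rel (x # u) (y # v)" if "x \<in> G" "y \<in> G" "x \<noteq> y"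
  proof -
    obtain u v where c: "complement (std 0) x y = (u, v)" by fastforce
    then have "gcomp x u y v" using that e by (auto simp: gcomp_def intro!: exI[of _ 0])
    moreover have "rel (x # u) (y # v)" using complement_rel that c by blast
    ultimately show ?thesis by blast
  qed
  show "swap_eq gstep u v" if "rel u v"
    using that by (rule rels_sound)
  show "\<exists>xz zx c d u v f. gcomp x xz z zx \<and> reverses gcomp zx [g] c d \<and> gcomp x u y v \<and>
      swap_eq gstep (xz @ c) (u @ f) \<and> swap_eq gstep (h # d) (v @ f)"
    if g: "gstep z g y h" and x: "x \<in> G" "x \<noteq> z" "x \<noteq> y"
  proof -
    have "e \<ge> 2"
    proof (rule ccontr)
      assume "\<not> e \<ge> 2"
      then have "e = 1" "n \<le> 1" using e n by auto
      then have "G \<subseteq> {E 0 0}" by (auto simp: gens_def)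
      then show False using g x by (auto simp: gstep_def)
    qed
    then show ?thesis using cube_condition[OF _ g x] unfolding cube_at_def by blast
  qed
qed

section \<open>Common multiples\<close>

context proper_braid_presentation
begin

notation eqv (infix "\<approx>" 50)
notation dv (infix "\<preceq>" 50)

definition chain where "chain p q = map (\<lambda>k. A k (Suc k)) [p..<q]"

lemma chain_Nil [simp]: "chain p p = []"
  by (simp add: chain_def)

lemma chain_Suc: "p \<le> q \<Longrightarrow> chain p (Suc q) = chain p q @ [A q (Suc q)]"
  by (simp add: chain_def)

lemma chain_Cons: "p < q \<Longrightarrow> chain p q = A p (Suc p) # chain (Suc p) q"
  by (simp add: chain_def upt_conv_Cons)

lemma chain_append: "p \<le> r \<Longrightarrow> r \<le> q \<Longrightarrow> chain p q = chain p r @ chain r q"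
  using upt_add_eq_append[of p r "q - r"] by (simp add: chain_def)

lemma chain_lists: "q < n \<Longrightarrow> chain p q \<in> lists G"
  by (auto simp: chain_def)

lemma step_Suc [simp]: "step p (Suc p) k = k"
  by (simp add: step_def)

lemma T_chain:
  assumes "p \<le> q" "q < n" "k < e"
  shows "T p k @ chain p q \<approx> chain p q @ T q k"
  using assms(1,2)
proof (induction q rule: dec_induct)
  case (step q)
  have "T p k @ chain p (Suc q) \<approx> chain p q @ T q k @ [A q (Suc q)]"
    using eqv_in[OF step.IH, of "[]" "[A q (Suc q)]"] step.prems step.hyps by (simp add: chain_Suc)
  also have "\<dots> \<approx> chain p (Suc q) @ T (Suc q) k"
    using eqv_in[OF T_right[of q "Suc q" k], of "chain p q" "[]"] step.prems step.hyps assms(3)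
    by (simp add: chain_Suc)
  finally show ?case .
qed simp

lemma E_chain:
  assumes "p \<le> q" "q < n" "k < e"
  shows "E p k # chain p q \<approx> chain p q @ [E q k]"
  using assms(1,2)
proof (induction q rule: dec_induct)
  case (step q)
  have "E p k # chain p (Suc q) \<approx> chain p q @ [E q k, A q (Suc q)]"
    using eqv_in[OF step.IH, of "[]" "[A q (Suc q)]"] step.prems step.hyps by (simp add: chain_Suc)
  also have "\<dots> \<approx> chain p (Suc q) @ [E (Suc q) k]"
    using eqv_in[OF eqv_sym[OF eqv_R5b[of q "Suc q" k]], of "chain p q" "[]"]
      step.prems step.hyps assms(3) by (simp add: chain_Suc)
  finally show ?case .
qed simp

lemma A_chain:
  assumes "1 \<le> q" "q < n"
  shows "A 0 1 # chain 1 q \<approx> chain 1 q @ [A 0 q]"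
  using assms
proof (induction q rule: dec_induct)
  case (step q)
  have "A 0 1 # chain 1 (Suc q) \<approx> chain 1 q @ [A 0 q, A q (Suc q)]"
    using eqv_in[OF step.IH, of "[]" "[A q (Suc q)]"] step.prems step.hyps by (simp add: chain_Suc)
  also have "\<dots> \<approx> chain 1 (Suc q) @ [A 0 (Suc q)]"
    using eqv_in[OF eqv_R3a[of 0 q "Suc q"], of "chain 1 q" "[]"] step.prems step.hyps
    by (simp add: chain_Suc co_def)
  finally show ?case .
qed simp

lemma chain_commute:
  assumes "\<And>k. p \<le> k \<Longrightarrow> k < q \<Longrightarrow> [x, A k (Suc k)] \<approx> [A k (Suc k), x]"
  shows "x # chain p q \<approx> chain p q @ [x]"
proof (cases "p \<le> q")
  case True
  then show ?thesis using assms
  proof (induction q rule: dec_induct)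
    case (step q)
    have "x # chain p (Suc q) \<approx> chain p q @ [x, A q (Suc q)]"
      using eqv_in[OF step.IH, of "[]" "[A q (Suc q)]"] step.prems step.hyps by (simp add: chain_Suc)
    also have "\<dots> \<approx> chain p (Suc q) @ [x]"
      using eqv_in[OF step.prems[of q], of "chain p q" "[]"] step.hyps by (simp add: chain_Suc)
    finally show ?case .
  qed simp
qed (simp add: chain_def)

text \<open>Moving a letter past \<delta> to the right lowers its subscript by one modulo n.
  Exponents drop by one, or by two when the subscript wraps from 0 to n - 1.\<close>

definition \<delta> where "\<delta> = chain 0 (n - 1) @ T (n - 1) 0"

context
  assumes n1: "n \<ge> 1"
begin

lemma \<delta>_lists: "\<delta> \<in> lists G"
  using chain_lists[of "n - 1" 0] n1 e by (simp add: \<delta>_def T_def)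

lemma \<delta>_eq: "k < e \<Longrightarrow> \<delta> \<approx> T 0 k @ chain 0 (n - 1)"
proof -
  assume k: "k < e"
  have "\<delta> \<approx> chain 0 (n - 1) @ T (n - 1) k"
    unfolding \<delta>_def using n1 k e by (intro eqv_append eqv_refl T_eq) auto
  also have "\<dots> \<approx> T 0 k @ chain 0 (n - 1)"
    using n1 k by (intro eqv_sym[OF T_chain]) auto
  finally show ?thesis .
qed

text \<open>Starting \<delta> with \<open>T 0 (dn (dn k))\<close> lines up three exponents, each the
  predecessor of the one before. The first two letters form another \<open>T 0\<close>, and the
  third slides along the chain.\<close>

lemma shift_E0: "k < e \<Longrightarrow> E 0 k # \<delta> \<approx> \<delta> @ [E (n - 1) (dn (dn k))]"
proof -
  assume k: "k < e"
  have "E 0 k # \<delta> \<approx> T 0 (dn k) @ E 0 (dn (dn k)) # chain 0 (n - 1)"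
    using eqv_Cons[OF \<delta>_eq[of "dn (dn k)"], of "E 0 k"] k by (simp add: T_def)
  also have "\<dots> \<approx> T 0 (dn k) @ chain 0 (n - 1) @ [E (n - 1) (dn (dn k))]"
    using n1 by (intro eqv_append eqv_refl E_chain) auto
  also have "\<dots> \<approx> \<delta> @ [E (n - 1) (dn (dn k))]"
    using eqv_append[OF eqv_sym[OF \<delta>_eq[of "dn k"]] eqv_refl[of "[E (n - 1) (dn (dn k))]"]] by simp
  finally show ?thesis .
qed

lemma shift_A0: "n \<ge> 2 \<Longrightarrow> A 0 1 # \<delta> \<approx> \<delta> @ [A (n - 1) 0]"
proof -
  assume n2: "n \<ge> 2"
  then have \<delta>: "\<delta> = A 0 1 # chain 1 (n - 1) @ T (n - 1) 0"
    by (simp add: \<delta>_def chain_Cons)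
  have "\<delta> @ [A (n - 1) 0] \<approx> A 0 1 # chain 1 (n - 1) @ A 0 (n - 1) # T (n - 1) 0"
    using eqv_in[OF T_left[of "n - 1" 0 0], of "A 0 1 # chain 1 (n - 1)" "[]"] n2 e by (simp add: \<delta>)
  also have "\<dots> \<approx> A 0 1 # A 0 1 # chain 1 (n - 1) @ T (n - 1) 0"
    using eqv_in[OF eqv_sym[OF A_chain[of "n - 1"]], of "[A 0 1]" "T (n - 1) 0"] n2 by simp
  finally show ?thesis using eqv_sym by (simp add: \<delta>)
qed

text \<open>With a and b the two consecutive chain letters, R3 gives the braid relation b a b = a b
  a; all remaining factors of \<delta> commute with b on the left and with a on the right.\<close>

lemma shift_A_Suc:
  assumes m: "Suc (Suc m) < n"
  shows "A (Suc m) (Suc (Suc m)) # \<delta> \<approx> \<delta> @ [A m (Suc m)]"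
proof -
  let ?a = "A m (Suc m)" and ?b = "A (Suc m) (Suc (Suc m))" and ?c = "A m (Suc (Suc m))"
  let ?l = "chain 0 m" and ?r = "chain (Suc (Suc m)) (n - 1)" and ?t = "T (n - 1) 0"
  have \<delta>: "\<delta> = ?l @ [?a, ?b] @ ?r @ ?t"
  proof -
    have "chain 0 (n - 1) = ?l @ chain m (n - 1)" using m by (intro chain_append) auto
    then show ?thesis using m by (simp add: \<delta>_def chain_Cons)
  qed
  have co: "co m (Suc m) (Suc (Suc m))" "co m (Suc m) (n - 1)" using m by (auto simp: co_def)
  have "?b # \<delta> \<approx> ?l @ [?b] @ [?a, ?b] @ ?r @ ?t"
    unfolding \<delta> using eqv_in[OF chain_commute[of 0 m ?b], of "[]" "[?a, ?b] @ ?r @ ?t"]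
      eqv_sym[OF eqv_R1[of _ _ "Suc m" "Suc (Suc m)"]] m by (simp add: co_def)
  also have "\<dots> \<approx> ?l @ [?b, ?c, ?a] @ ?r @ ?t"
    using eqv_in[OF eqv_trans[OF eqv_R3a eqv_R3b], of m "Suc m" "Suc (Suc m)" "?l @ [?b]" "?r @ ?t"]
      co m by simp
  also have "\<dots> \<approx> ?l @ [?a, ?b, ?a] @ ?r @ ?t"
    using eqv_in[OF eqv_sym[OF eqv_R3a], of m "Suc m" "Suc (Suc m)" "?l" "?a # ?r @ ?t"] co m by simp
  also have "\<dots> \<approx> ?l @ [?a, ?b] @ ?r @ [?a] @ ?t"
    using eqv_in[OF chain_commute[of "Suc (Suc m)" "n - 1" ?a], of "?l @ [?a, ?b]" ?t]
      eqv_R1[of m "Suc m"] m by (simp add: co_def)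
  also have "\<dots> \<approx> \<delta> @ [?a]"
    unfolding \<delta> using eqv_in[OF eqv_sym[OF T_comm[of m "Suc m" "n - 1" 0]], of "?l @ [?a, ?b] @ ?r" "[]"]
      co m e by simp
  finally show ?thesis .
qed

text \<open>If z is the conjugate of x by y, the shifts of x and y determine that of z. This uses
  cancellation of y, available from the cube condition.\<close>

lemma shift_conj:
  assumes x: "x # \<delta> \<approx> \<delta> @ [x']" and y: "y # \<delta> \<approx> \<delta> @ [y']"
    and xy: "[x, y] \<approx> [y, z]" "[x', y'] \<approx> [y', w]" and G: "y \<in> G" "z \<in> G"
  shows "z # \<delta> \<approx> \<delta> @ [w]"
proof -
  have "[y] @ z # \<delta> \<approx> x # y # \<delta>"
    using eqv_append[OF eqv_sym[OF xy(1)] eqv_refl[of \<delta>]] by simp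
  also have "\<dots> \<approx> x # \<delta> @ [y']" using eqv_Cons[OF y] .
  also have "\<dots> \<approx> \<delta> @ [x', y']" using eqv_append[OF x eqv_refl[of "[y']"]] by simp
  also have "\<dots> \<approx> \<delta> @ [y', w]" using eqv_append[OF eqv_refl xy(2)] .
  also have "\<dots> \<approx> [y] @ \<delta> @ [w]" using eqv_append[OF eqv_sym[OF y] eqv_refl[of "[w]"]] by simp
  finally show ?thesis using eqv_cancel[of "[y]" "z # \<delta>" "\<delta> @ [w]"] G \<delta>_lists by simp
qed

lemma shift_E:
  assumes "0 < p" "p < n" "k < e"
  shows "E p k # \<delta> \<approx> \<delta> @ [E (p - 1) (dn k)]"
  using assms(1,2)
proof (induction p)
  case (Suc p)
  have xy: "[E p k, A p (Suc p)] \<approx> [A p (Suc p), E (Suc p) k]"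
    using eqv_sym[OF eqv_R5b[of p "Suc p" k]] Suc.prems assms(3) by simp
  show ?case
  proof (cases p)
    case 0
    then have "[E (n - 1) (dn (dn k)), A (n - 1) 0] \<approx> [A (n - 1) 0, E 0 (dn k)]"
      using eqv_sym[OF eqv_R5b[of "n - 1" 0 "dn (dn k)"]] Suc.prems assms(3) by (simp add: step_def)
    moreover have "A 0 (Suc 0) # \<delta> \<approx> \<delta> @ [A (n - 1) 0]" using shift_A0 Suc.prems 0 by simp
    ultimately show ?thesis
      using shift_conj[OF shift_E0 _ xy[unfolded 0]] 0 Suc.prems assms(3) by simp
  next
    case p: (Suc m)
    have "[E m (dn k), A m p] \<approx> [A m p, E p (dn k)]"
      using eqv_sym[OF eqv_R5b[of m p "dn k"]] Suc.prems p by simp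
    then show ?thesis
      using shift_conj[OF _ shift_A_Suc[of m] xy[unfolded p]] Suc p assms(3) by simp
  qed
qed simp

lemma shift_G:
  assumes "x \<in> G" shows "\<exists>y\<in>G. x # \<delta> \<approx> \<delta> @ [y]"
  using assms
proof (cases rule: G_cases)
  case (2 p k)
  show ?thesis
  proof (cases "p = 0")
    case True
    then show ?thesis using shift_E0 2 n1 by (auto intro!: bexI[of _ "E (n - 1) (dn (dn k))"])
  next
    case False
    then show ?thesis using shift_E[of p k] 2 by (auto intro!: bexI[of _ "E (p - 1) (dn k)"])
  qed
next
  case (1 p q)
  \<comment> \<open>The extra decrement at p = 0 compensates for the reversed order of subscripts
    after wrapping. The generator a_pq is then handled as the conjugate of a_q^(j) by
    a_p^(0).\<close>
  define sp where "sp p = (if p = 0 then n - 1 else p - 1)" for p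
  define sk where "sk p k = (if p = 0 then dn (dn k) else dn k)" for p :: nat and k
  have E: "E p k # \<delta> \<approx> \<delta> @ [E (sp p) (sk p k)]" if "p < n" "k < e" for p k
    using shift_E0 shift_E[of p k] that by (simp add: sp_def sk_def)
  have sp: "sp p < n" "sp q < n" "sp p \<noteq> sp q" using 1 by (auto simp: sp_def)
  have e0: "0 < e" using e by simp
  have "sk q (step p q 0) = step (sp p) (sp q) (sk p 0)"
    using 1 e0 by (auto simp: sk_def sp_def step_def)
  then have "[E (sp q) (sk q (step p q 0)), E (sp p) (sk p 0)] \<approx> [E (sp p) (sk p 0), A (sp p) (sp q)]"
    using eqv_trans[OF eqv_sym[OF eqv_R5a] eqv_R5b, of "sp p" "sp q" "sk p 0"] sp by (simp add: sk_def)
  moreover have "[E q (step p q 0), E p 0] \<approx> [E p 0, A p q]"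
    using eqv_trans[OF eqv_sym[OF eqv_R5a] eqv_R5b, of p q 0] 1 e0 by simp
  ultimately have "A p q # \<delta> \<approx> \<delta> @ [A (sp p) (sp q)]"
    using 1 e0 by (intro shift_conj[OF E E]) auto
  then show ?thesis using 1(1) sp by (intro bexI[of _ "A (sp p) (sp q)"]) auto
qed

lemma shift_lists: "w \<in> lists G \<Longrightarrow> \<exists>w'\<in>lists G. w @ \<delta> \<approx> \<delta> @ w'"
proof (induction w)
  case (Cons x w)
  then obtain w' where w': "w' \<in> lists G" "w @ \<delta> \<approx> \<delta> @ w'" by fastforce
  obtain y where y: "y \<in> G" "x # \<delta> \<approx> \<delta> @ [y]" using shift_G[of x] Cons.prems by auto
  have "x # w @ \<delta> \<approx> x # \<delta> @ w'" using eqv_Cons[OF w'(2)] .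
  also have "\<dots> \<approx> \<delta> @ y # w'" using eqv_append[OF y(2) eqv_refl[of w']] by simp
  finally show ?case using w'(1) y(1) by (intro bexI[of _ "y # w'"]) auto
qed (auto intro!: bexI[of _ "[]"])

text \<open>If \<delta> = x w, moving \<delta> left across w gives \<delta> \<delta> = x \<delta> w'
  = \<delta> y w', and one \<delta> cancels.\<close>

lemma divides_shift:
  assumes "[x] \<preceq> \<delta>" "x # \<delta> \<approx> \<delta> @ [y]"
  shows "[y] \<preceq> \<delta>"
proof -
  obtain w where w: "w \<in> lists G" "x # w \<approx> \<delta>" using assms(1) by (auto simp: dv_def)
  obtain w' where w': "w' \<in> lists G" "w @ \<delta> \<approx> \<delta> @ w'" using shift_lists w(1) by blast
  have "\<delta> @ \<delta> \<approx> x # w @ \<delta>" using eqv_append[OF eqv_sym[OF w(2)] eqv_refl[of \<delta>]] by simp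
  also have "\<dots> \<approx> x # \<delta> @ w'" using eqv_Cons[OF w'(2)] .
  also have "\<dots> \<approx> \<delta> @ y # w'" using eqv_append[OF assms(2) eqv_refl[of w']] by simp
  finally have "\<delta> \<approx> y # w'" using eqv_cancel \<delta>_lists by simp
  then show ?thesis using w'(1) eqv_sym by (intro dvI[of w']) auto
qed

text \<open>Divisibility is visible for subscript 0. The shift carries it to n - 1 and from there
  down one subscript at a time, so the induction descends.\<close>

lemma E_divides: "p < n \<Longrightarrow> k < e \<Longrightarrow> [E p k] \<preceq> \<delta>"
proof -
  have 0: "[E 0 k] \<preceq> \<delta>" if "k < e" for k
    using eqv_sym[OF \<delta>_eq[of "dn k"]] that n1 chain_lists[of "n - 1" 0]
    by (intro dvI[of "E 0 (dn k) # chain 0 (n - 1)"]) (auto simp: T_def)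
  have last: "[E (n - 1) k] \<preceq> \<delta>" if "k < e" for k
    using divides_shift[OF 0 shift_E0, of "up (up k)"] that by simp
  have "[E p k] \<preceq> \<delta>" if "p \<le> n - 1" "k < e" for p k
    using that
  proof (induction arbitrary: k rule: inc_induct)
    case (step p)
    have "[E (Suc p) (up k)] \<preceq> \<delta>" using step.IH step.prems by simp
    from divides_shift[OF this shift_E[of "Suc p" "up k"]] show ?case
      using step by simp
  qed (rule last)
  then show "p < n \<Longrightarrow> k < e \<Longrightarrow> [E p k] \<preceq> \<delta>" by simp
qed

text \<open>By R5, a_pq left divides a_q^(j) a_p^(0). The second letter is completed to \<delta>;
  the first passes that \<delta> and becomes a letter which again divides \<delta>.\<close>

lemma G_divides:
  assumes "x \<in> G" shows "[x] \<preceq> \<delta> @ \<delta>"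
  using assms
proof (cases rule: G_cases)
  case (2 p k)
  then have "[x] \<preceq> \<delta>" using E_divides by simp
  moreover have "\<delta> \<preceq> \<delta> @ \<delta>" using \<delta>_lists by (intro dvI[of \<delta>]) auto
  ultimately show ?thesis by (rule dv_trans)
next
  case (1 p q)
  have e0: "0 < e" using e by simp
  let ?i = "step p q 0"
  obtain w where w: "w \<in> lists G" "E p 0 # w \<approx> \<delta>"
    using E_divides[of p 0] 1 e0 by (auto simp: dv_def)
  have i: "[E q ?i] \<preceq> \<delta>" using E_divides[of q ?i] 1 e0 by simp
  have "E q ?i \<in> G" using 1 e0 by simp
  then obtain y where y: "y \<in> G" "E q ?i # \<delta> \<approx> \<delta> @ [y]" using shift_G by blast
  obtain w' where w': "w' \<in> lists G" "y # w' \<approx> \<delta>"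
    using divides_shift[OF i y(2)] by (auto simp: dv_def)
  have "[A p q] @ E q ?i # w @ w' \<approx> E q ?i # E p 0 # w @ w'"
    using eqv_append[OF eqv_R5a[of p q 0] eqv_refl[of "w @ w'"]] 1 e0 by simp
  also have "\<dots> \<approx> E q ?i # \<delta> @ w'"
    using eqv_Cons[OF eqv_append[OF w(2) eqv_refl[of w']]] by simp
  also have "\<dots> \<approx> \<delta> @ y # w'" using eqv_append[OF y(2) eqv_refl[of w']] by simp
  also have "\<dots> \<approx> \<delta> @ \<delta>" using eqv_append[OF eqv_refl w'(2)] .
  finally show ?thesis using 1 e0 w(1) w'(1) by (intro dvI[of "E q ?i # w @ w'"]) auto
qed

lemma shift_square:
  assumes "x \<in> G" shows "\<exists>y\<in>G. x # \<delta> @ \<delta> \<approx> (\<delta> @ \<delta>) @ [y]"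
proof -
  obtain y where y: "y \<in> G" "x # \<delta> \<approx> \<delta> @ [y]" using shift_G assms by blast
  obtain z where z: "z \<in> G" "y # \<delta> \<approx> \<delta> @ [z]" using shift_G y(1) by blast
  have "x # \<delta> @ \<delta> \<approx> \<delta> @ y # \<delta>" using eqv_append[OF y(2) eqv_refl[of \<delta>]] by simp
  also have "\<dots> \<approx> (\<delta> @ \<delta>) @ [z]" using eqv_append[OF eqv_refl[of \<delta>] z(2)] by simp
  finally show ?thesis using z(1) by blast
qed

end

theorem lattice_Bplus: "lattice (left_division_order (Bplus e n))"
  unfolding Bplus_def
proof (rule lattice_left_division)
  fix u v assume uv: "u \<in> lists G" "v \<in> lists G"
  show "\<exists>m\<in>lists G. u \<preceq> m \<and> v \<preceq> m"
  proof (cases "n \<ge> 1")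
    case True
    then show ?thesis
      using common_multiples[OF _ G_divides shift_square uv] \<delta>_lists by simp
  next
    case False
    then have "G = {}" by (auto simp: gens_def)
    then have "u = []" "v = []" using uv by auto
    moreover have "[] \<preceq> []" by (rule dvI[of "[]"]) auto
    ultimately show ?thesis by auto
  qed
qed

end

theorem theorem8:
  fixes e r n :: nat
  assumes "e \<ge> 1" and "r \<ge> 1" and "n = r - 1"
    and "e = 1 \<longrightarrow> r \<le> 2"
  shows "right_complete (gens e n) (rels_Rplus e n) \<and>
         left_cancellative (Bplus e n) \<and>
         lattice (left_division_order (Bplus e n))"
proof -
  interpret proper_braid_presentation e n
    by unfold_locales (use assms in auto)
  show ?thesis
    using right_complete left_cancellative lattice_Bplus by (simp add: Bplus_def)
qed

end
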